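(* Let $f_0:\mathbb{R}^n\to\mathbb{R}$ be locally Lipschitz continuous, let $X\subset\mathbb{R}^n$ be nonempty and compact, and for $k=1,\dots,s$ and $i=1,\dots,r_k$ let $f_{ik}:\mathbb{R}^{m_k}\times\mathbb{R}^n\to\mathbb{R}$ be continuously differentiable. Let $m=\sum_{k=1}^s m_k$, and let $\bar u=(\bar u^1,\dots,\bar u^s)\in\mathbb{R}^m$ with $\bar u^k\in\mathbb{R}^{m_k}$. For each $k$ let $\|\cdot\|_{(k)}$ be a norm on $\mathbb{R}^{m_k}$. For $u=(u^1,\dots,u^s)\in\mathbb{R}^m$ and $\delta\in\mathbb{R}$ define \[ U(u,\delta)=\Big\{(v^1,\dots,v^s)\in\mathbb{R}^m ~\Big|~ \max_{k=1,\dots,s}\|v^k-u^k\|_{(k)}\le|\delta|\Big\} \] and the min-value function $p:\mathbb{R}^{m+1}\to[-\infty,\infty]$, \[ p(u,\delta)=\inf_{x\in X}\ \sup_{v\in U(u,\delta)}\ f_0(x)+\sum_{k=1}^s\max_{i=1,\dots,r_k} f_{ik}(v^k,x). \] Let $M$ be the set of minimizers of the problem $\min_{x\in X} f_0(x)+\sum_{k=1}^s\max_{i=1,\dots,r_k} f_{ik}(\bar u^k,x)$, and for $x\in\mathbb{R}^n$ and $k=1,\dots,s$ let \[ I_k(x)=\Big\{i ~\Big|~ f_{ik}(\bar u^k,x)=\max_{j=1,\dots,r_k} f_{jk}(\bar u^k,x)\Big\}. \] Then $p$ is locally Lipschitz continuous at $(\bar u,0)$ with local Lipschitz modulus \[ \operatorname{lip}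 p(\bar u,0)\le \max_{\bar x\in M}\sum_{k=1}^s\sum_{i\in I_k(\bar x)}\ \max_{\|w_i^k\|_{(k)}\le 1}\sqrt{\big\|\nabla_1 f_{ik}(\bar u^k,\bar x)\big\|_2^2+\big(\langle\nabla_1 f_{ik}(\bar u^k,\bar x),w_i^k\rangle\big)^2}, \] where the right-hand side simplifies to $\sqrt{2}\max_{\bar x\in M}\sum_{k=1}^s\sum_{i\in I_k(\bar x)}\|\nabla_1 f_{ik}(\bar u^k,\bar x)\|_2$ when $\|\cdot\|_{(k)}=\|\cdot\|_2$ for all $k$. Moreover, for each subgradient $(g,\gamma)\in\partial p(\bar u,0)$ (with $g\in\mathbb{R}^m$, $\gamma\in\mathbb{R}$), there exist a minimizer $\bar x\in M$ and multipliers $\{w_i^k\in\mathbb{R}^{m_k},\ y_i^k\ge 0:\ i\in I_k(\bar x),\ k=1,\dots,s\}$ such that \[ g=\sum_{k=1}^s\sum_{i\in I_k(\bar x)} y_i^k\,\nabla_1 f_{ik}(\bar u^k,\bar x),\qquad \gamma=\sum_{k=1}^s\sum_{i\in I_k(\bar x)} y_i^k\,\big\langle\nabla_1 f_{ik}(\bar u^k,\bar x),w_i^k\big\rangle, \] where for all $k$, $\|w_i^k\|_{(k)}\le 1$ and $\sum_{i\in I_k(\bar x)} y_i^k=1$.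
   Context: $\nabla_1 f_{ik}(u^k,x)$ denotes the gradient of $f_{ik}(\cdot,x)$ at $u^k$ for fixed $x$. A function $f:\mathbb{R}^N\to[-\infty,\infty]$ is locally Lipschitz continuous at $\bar z$ if it is real-valued on a neighborhood of $\bar z$ and there exist $\kappa\in[0,\infty)$ and $\epsilon>0$ with $|f(z)-f(z')|\le\kappa\|z-z'\|_2$ whenever $\|z-\bar z\|_2\le\epsilon$, $\|z'-\bar z\|_2\le\epsilon$; it is locally Lipschitz continuous if this holds at every point. The local Lipschitz modulus is $\operatorname{lip} f(\bar z)=\limsup_{z,z'\to\bar z,\ z\ne z'}|f(z)-f(z')|/\|z-z'\|_2$. For $f$ finite at $\bar z$, $\partial f(\bar z)$ denotes the set of (general, i.e. Mordukhovich/limiting) subgradients of $f$ at $\bar z$. *)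

theory Defs
  imports "HOL-Analysis.Analysis"
begin

text \<open>Block structure: the coordinates of R^m (index type 'm) are partitioned
 into blocks 1..s by blk; block k is identified with R^(m_k).\<close>

definition blockpart :: "('m \<Rightarrow> nat) \<Rightarrow> nat \<Rightarrow> real^'m \<Rightarrow> real^'m" where
  "blockpart blk k v = (\<chi> j. if blk j = k then v $ j else 0)"

definition block_space :: "('m \<Rightarrow> nat) \<Rightarrow> nat \<Rightarrow> (real^'m) set" where
  "block_space blk k = {v. \<forall>j. blk j \<noteq> k \<longrightarrow> v $ j = 0}"

definition is_norm_on :: "'a::real_vector set \<Rightarrow> ('a \<Rightarrow> real) \<Rightarrow> bool" where
  "is_norm_on S N \<longleftrightarrow>
     (\<forall>v\<in>S. 0 \<le> N v \<and> (N v = 0 \<longleftrightarrow> v = 0) \<and> (\<forall>a. N (a *\<^sub>R v) = \<bar>a\<bar> * N v)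
             \<and> (\<forall>w\<in>S. N (v + w) \<le> N v + N w))"

definition loc_lip_at :: "('a::metric_space \<Rightarrow> ereal) \<Rightarrow> 'a \<Rightarrow> bool" where
  "loc_lip_at f zb \<longleftrightarrow>
     (\<exists>\<kappa>\<ge>0. \<exists>\<epsilon>>0.
        (\<forall>z. dist z zb \<le> \<epsilon> \<longrightarrow> \<bar>f z\<bar> \<noteq> \<infinity>) \<and>
        (\<forall>z z'. dist z zb \<le> \<epsilon> \<longrightarrow> dist z' zb \<le> \<epsilon> \<longrightarrow>
            \<bar>real_of_ereal (f z) - real_of_ereal (f z')\<bar> \<le> \<kappa> * dist z z'))"

definition loc_lip :: "('a::metric_space \<Rightarrow> ereal) \<Rightarrow> bool" where
  "loc_lip f \<longleftrightarrow> (\<forall>z. loc_lip_at f z)"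

definition lip_mod :: "('a::metric_space \<Rightarrow> ereal) \<Rightarrow> 'a \<Rightarrow> ereal" where
  "lip_mod f zb = Limsup (at (zb, zb) within {(z, z'). z \<noteq> z'})
      (\<lambda>(z, z'). ereal (\<bar>real_of_ereal (f z) - real_of_ereal (f z')\<bar> / dist z z'))"

definition C1_fun :: "('a::real_normed_vector \<Rightarrow> real) \<Rightarrow> bool" where
  "C1_fun F \<longleftrightarrow> (\<exists>F'. (\<forall>z. (F has_derivative blinfun_apply (F' z)) (at z)) \<and> continuous_on UNIV F')"

definition regular_subgrad :: "('a::real_inner \<Rightarrow> ereal) \<Rightarrow> 'a \<Rightarrow> 'a \<Rightarrow> bool" where
  "regular_subgrad f zb v \<longleftrightarrow> \<bar>f zb\<bar> \<noteq> \<infinity> \<and>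
     (\<forall>e>0. \<exists>d>0. \<forall>z. dist z zb < d \<longrightarrow>
        ereal (real_of_ereal (f zb) + inner v (z - zb) - e * norm (z - zb)) \<le> f z)"

definition limiting_subdiff :: "('a::real_inner \<Rightarrow> ereal) \<Rightarrow> 'a \<Rightarrow> 'a set" where
  "limiting_subdiff f zb = {v. \<bar>f zb\<bar> \<noteq> \<infinity> \<and>
     (\<exists>Z V. Z \<longlonglongrightarrow> zb \<and> (\<lambda>j. f (Z j)) \<longlonglongrightarrow> f zb \<and>
            (\<forall>j. regular_subgrad f (Z j) (V j)) \<and> V \<longlonglongrightarrow> v)}"

definition grad1 :: "(real^'m \<Rightarrow> 'b \<Rightarrow> real) \<Rightarrow> real^'m \<Rightarrow> 'b \<Rightarrow> real^'m" where
  "grad1 F u x = (THE g. GDERIV (\<lambda>v. F v x) u :> g)"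

definition objective ::
  "('n \<Rightarrow> real) \<Rightarrow> nat \<Rightarrow> (nat \<Rightarrow> nat) \<Rightarrow> (nat \<Rightarrow> nat \<Rightarrow> 'u \<Rightarrow> 'n \<Rightarrow> real) \<Rightarrow> 'u \<Rightarrow> 'n \<Rightarrow> real" where
  "objective f0 s r f v x = f0 x + (\<Sum>k=1..s. Max ((\<lambda>i. f k i v x) ` {1..r k}))"

definition Uset :: "('m \<Rightarrow> nat) \<Rightarrow> nat \<Rightarrow> (nat \<Rightarrow> real^'m \<Rightarrow> real) \<Rightarrow> real^'m \<Rightarrow> real \<Rightarrow> (real^'m) set" where
  "Uset blk s nrm u \<delta> = {v. Max ((\<lambda>k. nrm k (blockpart blk k (v - u))) ` {1..s}) \<le> \<bar>\<delta>\<bar>}"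

definition minval ::
  "('m \<Rightarrow> nat) \<Rightarrow> nat \<Rightarrow> (nat \<Rightarrow> real^'m \<Rightarrow> real) \<Rightarrow> ('n \<Rightarrow> real) \<Rightarrow> 'n set \<Rightarrow> (nat \<Rightarrow> nat)
    \<Rightarrow> (nat \<Rightarrow> nat \<Rightarrow> real^'m \<Rightarrow> 'n \<Rightarrow> real) \<Rightarrow> (real^'m) \<times> real \<Rightarrow> ereal" where
  "minval blk s nrm f0 X r f z =
     (INF x\<in>X. SUP v\<in>Uset blk s nrm (fst z) (snd z). ereal (objective f0 s r f v x))"

definition minimizers :: "'n set \<Rightarrow> ('n \<Rightarrow> real) \<Rightarrow> 'n set" where
  "minimizers X F = {x \<in> X. \<forall>x'\<in>X. F x \<le> F x'}"

definition active :: "(nat \<Rightarrow> nat) \<Rightarrow> (nat \<Rightarrow> nat \<Rightarrow> 'u \<Rightarrow> 'n \<Rightarrow> real) \<Rightarrow> 'u \<Rightarrow> nat \<Rightarrow> 'n \<Rightarrow> nat set" where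
  "active r f ub k x = {i \<in> {1..r k}. f k i ub x = Max ((\<lambda>j. f k j ub x) ` {1..r k})}"

end

theory Submission
  imports Defs
begin

text \<open>Writing \<open>v = u + \<delta> w\<close> with \<open>w\<close> in the product of the unit balls turns the inner supremum at
  \<open>(u, \<delta>)\<close> into a maximum over a fixed compact index set, and a sum of maxima is a maximum of sums
  over selections \<open>\<iota>\<close> of one index per block. The value function is thus
  \<open>inf\<^sub>x max\<^sub>\<iota>\<^sub>,\<^sub>w F\<^sub>\<iota> (u + \<delta> w) x\<close>, whose pieces have at \<open>(ub, 0)\<close> the gradients
  \<open>(\<nabla>F\<^sub>\<iota>, \<langle>\<nabla>F\<^sub>\<iota>, w\<rangle>)\<close>. Freezing \<open>x\<close> at a minimiser and using the mean value theorem for a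
  maximising piece bounds increments of the value function by active gradients. Since minimisers
  at nearby parameters accumulate at minimisers of the nominal problem, this gives the Lipschitz
  modulus, and by separation every limiting subgradient lies in the convex hull of the active
  gradients at one nominal minimiser.\<close>

section \<open>Infima of parametric maxima\<close>

text \<open>Weierstrass' theorem for lower semicontinuous functions. The closed sets
  \<open>{x. h x \<le> h y}\<close> have the finite intersection property in \<open>X\<close>,
  because the index of least value lies in all of finitely many of them. A point common to all of
  them is a minimizer.\<close>

lemma compact_attains_inf_closed_sublevels:
  fixes h :: "'b::topological_space \<Rightarrow> real"
  assumes "compact X" "X \<noteq> {}" and cl: "\<And>c. closed {x. h x \<le> c}"
  shows "\<exists>x\<in>X. \<forall>y\<in>X. h x \<le> h y"
proof -
  have "X \<inter> (\<Inter>y\<in>X. {x. h x \<le> h y}) \<noteq> {}"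
  proof (rule compact_imp_fip_image[OF \<open>compact X\<close> cl])
    fix I assume I: "finite I" "I \<subseteq> X"
    show "X \<inter> (\<Inter>y\<in>I. {x. h x \<le> h y}) \<noteq> {}"
    proof (cases "I = {}")
      case False
      then obtain x where "x \<in> I" "h x = Min (h ` I)"
        using I Min_in[of "h ` I"] by (force simp del: Min_in)
      then have "x \<in> X \<inter> (\<Inter>y\<in>I. {x. h x \<le> h y})"
        using I by auto
      then show ?thesis by blast
    qed (use \<open>X \<noteq> {}\<close> in auto)
  qed
  then show ?thesis by blast
qed

section \<open>Finite families of smooth functions with a compact set of directions\<close>

locale minmax_family =
  fixes F :: "'i \<Rightarrow> 'a::euclidean_space \<Rightarrow> 'b::metric_space \<Rightarrow> real"
    and D :: "'i \<Rightarrow> 'a \<Rightarrow> 'b \<Rightarrow> 'a"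
    and J :: "'i set" and W :: "'a set" and X :: "'b set" and ub :: 'a
  assumes finite_J: "finite J" and J_ne: "J \<noteq> {}"
    and compact_W: "compact W" and W_ne: "W \<noteq> {}"
    and compact_X: "compact X" and X_ne: "X \<noteq> {}"
    and cont_F: "\<iota> \<in> J \<Longrightarrow> continuous_on UNIV (\<lambda>(v, x). F \<iota> v x)"
    and cont_D: "\<iota> \<in> J \<Longrightarrow> continuous_on UNIV (\<lambda>(v, x). D \<iota> v x)"
    and gderiv: "\<iota> \<in> J \<Longrightarrow> GDERIV (\<lambda>v. F \<iota> v x) v :> D \<iota> v x"
begin

definition worst :: "'a \<times> real \<Rightarrow> 'b \<Rightarrow> real" where
  "worst z x = (SUP t\<in>J \<times> W. F (fst t) (fst z + snd z *\<^sub>R snd t) x)"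

definition val :: "'a \<times> real \<Rightarrow> real" where
  "val z = (INF x\<in>X. worst z x)"

text \<open>At \<open>\<delta> = 0\<close> the value of a piece does not depend on the direction, so
  activity is a condition on \<open>\<iota>\<close> alone and every \<open>w \<in> W\<close>
  contributes a gradient.\<close>

definition active_grads :: "'b \<Rightarrow> ('a \<times> real) set" where
  "active_grads x = {(D \<iota> ub x, inner (D \<iota> ub x) w) | \<iota> w.
     \<iota> \<in> J \<and> w \<in> W \<and> F \<iota> ub x = worst (ub, 0) x}"

section \<open>Continuity, and attainment of the inner maximum and outer minimum\<close>

lemma continuous_on_F [continuous_intros]:
  assumes "\<iota> \<in> J" "continuous_on S g" "continuous_on S h"
  shows "continuous_on S (\<lambda>t. F \<iota> (g t) (h t))"
  using continuous_on_compose2[OF cont_F[OF assms(1)] continuous_on_Pair[OF assms(2,3)]]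
  by simp

lemma continuous_on_D [continuous_intros]:
  assumes "\<iota> \<in> J" "continuous_on S g" "continuous_on S h"
  shows "continuous_on S (\<lambda>t. D \<iota> (g t) (h t))"
  using continuous_on_compose2[OF cont_D[OF assms(1)] continuous_on_Pair[OF assms(2,3)]]
  by simp

text \<open>For each \<open>\<iota>\<close> compactness of \<open>W\<close> gives a best direction
  \<open>m \<iota>\<close>, and finiteness of \<open>J\<close> gives a best index among these. The
  supremum is therefore a maximum, which yields both claims.\<close>

lemma worst_attained_and_upper:
  shows worst_attained: "\<exists>\<iota>\<in>J. \<exists>w\<in>W. worst z x = F \<iota> (fst z + snd z *\<^sub>R w) x"
    and worst_upper: "\<iota> \<in> J \<Longrightarrow> w \<in> W \<Longrightarrow> F \<iota> (fst z + snd z *\<^sub>R w) x \<le> worst z x"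
proof -
  define H where "H t = F (fst t) (fst z + snd z *\<^sub>R snd t) x" for t
  have "\<exists>w\<in>W. \<forall>w'\<in>W. H (\<iota>, w') \<le> H (\<iota>, w)" if "\<iota> \<in> J" for \<iota>
    unfolding H_def fst_conv snd_conv
    by (intro continuous_attains_sup compact_W W_ne continuous_intros that)
  then obtain m where m: "\<And>\<iota>. \<iota> \<in> J \<Longrightarrow> m \<iota> \<in> W"
      "\<And>\<iota> w'. \<iota> \<in> J \<Longrightarrow> w' \<in> W \<Longrightarrow> H (\<iota>, w') \<le> H (\<iota>, m \<iota>)"
    by metis
  obtain \<iota>0 where \<iota>0: "\<iota>0 \<in> J" "H (\<iota>0, m \<iota>0) = Max ((\<lambda>\<iota>. H (\<iota>, m \<iota>)) ` J)"
    using Max_in[of "(\<lambda>\<iota>. H (\<iota>, m \<iota>)) ` J"] finite_J J_ne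
    by (metis (no_types, lifting) finite_imageI image_iff image_is_empty)
  have le: "H t \<le> H (\<iota>0, m \<iota>0)" if "t \<in> J \<times> W" for t
  proof -
    have "H t \<le> H (fst t, m (fst t))" using m(2)[of "fst t" "snd t"] that by auto
    also have "\<dots> \<le> H (\<iota>0, m \<iota>0)" unfolding \<iota>0 using that finite_J by (intro Max_ge) auto
    finally show ?thesis .
  qed
  have "(\<iota>0, m \<iota>0) \<in> J \<times> W" using \<iota>0 m by blast
  then have "worst z x = H (\<iota>0, m \<iota>0)"
    unfolding worst_def H_def[symmetric] using le by (intro cSup_eq_maximum) blast+
  then show "\<exists>\<iota>\<in>J. \<exists>w\<in>W. worst z x = F \<iota> (fst z + snd z *\<^sub>R w) x"
    and "\<iota> \<in> J \<Longrightarrow> w \<in> W \<Longrightarrow> F \<iota> (fst z + snd z *\<^sub>R w) x \<le> worst z x"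
    using \<iota>0(1) m(1) le[of "(\<iota>, w)"] by (auto simp: H_def)
qed

lemma worst_centre_attained: "\<exists>\<iota>\<in>J. worst (ub, 0) x = F \<iota> ub x"
  using worst_attained[of "(ub, 0)" x] by auto

lemma worst_centre_upper: "\<iota> \<in> J \<Longrightarrow> F \<iota> ub x \<le> worst (ub, 0) x"
  using worst_upper[of \<iota> _ "(ub, 0)" x] W_ne by auto

text \<open>A sublevel set of a supremum is the intersection of the sublevel sets of its continuous
  pieces. This is lower semicontinuity in \<open>x\<close>, which is what the existence of
  minimizers rests on.\<close>

lemma closed_worst_sublevel: "closed {x. worst z x \<le> c}"
proof -
  have "{x. worst z x \<le> c} = (\<Inter>\<iota>\<in>J. \<Inter>w\<in>W. {x. F \<iota> (fst z + snd z *\<^sub>R w) x \<le> c})"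
    by (auto intro: order_trans[OF worst_upper]) (metis worst_attained)
  also have "closed \<dots>"
    by (intro closed_INT ballI closed_Collect_le continuous_intros)
  finally show ?thesis .
qed

lemma worst_attains_inf: "\<exists>x\<in>X. \<forall>y\<in>X. worst z x \<le> worst z y"
  by (intro compact_attains_inf_closed_sublevels compact_X X_ne closed_worst_sublevel)

lemma val_eqI: "x \<in> X \<Longrightarrow> (\<And>y. y \<in> X \<Longrightarrow> worst z x \<le> worst z y) \<Longrightarrow> val z = worst z x"
  unfolding val_def by (intro cInf_eq_minimum) auto

lemma val_attained: "\<exists>x\<in>X. val z = worst z x"
  using worst_attains_inf val_eqI by blast

lemma val_le: "y \<in> X \<Longrightarrow> val z \<le> worst z y"
  using worst_attains_inf[of z] val_eqI[of _ z] by fastforce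

section \<open>First-order bounds near the reference point and limits of minimizers\<close>

lemma compact_active_grads: "compact (active_grads x)"
proof -
  have "active_grads x = (\<Union>\<iota>\<in>{\<iota>\<in>J. F \<iota> ub x = worst (ub, 0) x}.
      (\<lambda>w. (D \<iota> ub x, inner (D \<iota> ub x) w)) ` W)"
    unfolding active_grads_def by auto
  also have "compact \<dots>"
    using finite_J by (intro compact_UN compact_continuous_image continuous_intros compact_W) auto
  finally show ?thesis .
qed

text \<open>A maximiser \<open>(\<iota>, w)\<close> of the upper point is used at both points; near the reference point its
  \<open>\<iota>\<close> is active there and its gradient is close to an active one.\<close>

lemma worst_diff_le:
  assumes "e > 0"
  shows "\<exists>d>0. \<forall>z z' x. dist z (ub, 0) < d \<longrightarrow> dist z' (ub, 0) < d \<longrightarrow> dist x xb < d \<longrightarrow>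
     (\<exists>c\<in>active_grads xb. worst z x - worst z' x \<le> inner c (z - z') + e * norm (z - z'))"
proof -
  obtain B where B: "B > 0" "\<And>w. w \<in> W \<Longrightarrow> norm w \<le> B"
    using compact_imp_bounded[OF compact_W] by (meson bounded_pos)
  \<comment> \<open>Parameter increments are stretched by a factor of at most \<open>1 + B\<close>
    under \<open>(u, \<delta>) \<mapsto> u + \<delta> w\<close>. A gradient error \<open>e'\<close>
    thus costs at most \<open>e\<close> per unit of \<open>norm (z - z')\<close>.\<close>
  define e' where "e' = e / (1 + B)"
  have e': "e' > 0" using assms B by (simp add: e'_def)
  obtain \<iota>0 where \<iota>0: "\<iota>0 \<in> J" "worst (ub, 0) xb = F \<iota>0 ub xb"
    using worst_centre_attained by blast
  \<comment> \<open>A piece inactive at \<open>xb\<close> stays strictly below the active piece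
    \<open>F \<iota>0\<close> on a joint neighbourhood of \<open>(ub, xb)\<close>, so it cannot be
    maximal there. Finiteness of \<open>J\<close> makes the neighbourhood common to all
    pieces.\<close>
  have "\<forall>\<^sub>F t in nhds (ub, xb).
      (F \<iota> ub xb = worst (ub, 0) xb \<or> F \<iota> (fst t) (snd t) < F \<iota>0 (fst t) (snd t))
      \<and> dist (D \<iota> (fst t) (snd t)) (D \<iota> ub xb) < e'" if \<iota>: "\<iota> \<in> J" for \<iota>
  proof (rule eventually_conj)
    have "\<forall>\<^sub>F t in nhds (ub, xb). F \<iota> (fst t) (snd t) < F \<iota>0 (fst t) (snd t)"
      if "F \<iota> ub xb \<noteq> worst (ub, 0) xb"
    proof -
      have "F \<iota> ub xb < F \<iota>0 ub xb" using worst_centre_upper[OF \<iota>, of xb] that \<iota>0 by auto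
      moreover have "open {t. F \<iota> (fst t) (snd t) < F \<iota>0 (fst t) (snd t)}"
        by (intro open_Collect_less continuous_intros \<iota> \<iota>0)
      ultimately show ?thesis
        unfolding eventually_nhds by (metis (mono_tags, lifting) fst_conv mem_Collect_eq snd_conv)
    qed
    then show "\<forall>\<^sub>F t in nhds (ub, xb). F \<iota> ub xb = worst (ub, 0) xb \<or> F \<iota> (fst t) (snd t) < F \<iota>0 (fst t) (snd t)"
      by (cases "F \<iota> ub xb = worst (ub, 0) xb") auto
    have "open {t. dist (D \<iota> (fst t) (snd t)) (D \<iota> ub xb) < e'}"
      by (intro open_Collect_less continuous_intros \<iota>)
    then show "\<forall>\<^sub>F t in nhds (ub, xb). dist (D \<iota> (fst t) (snd t)) (D \<iota> ub xb) < e'"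
      unfolding eventually_nhds using e'
      by (metis (mono_tags, lifting) dist_self fst_conv mem_Collect_eq snd_conv)
  qed
  then have "\<forall>\<^sub>F t in nhds (ub, xb). \<forall>\<iota>\<in>J.
      (F \<iota> ub xb = worst (ub, 0) xb \<or> F \<iota> (fst t) (snd t) < F \<iota>0 (fst t) (snd t))
      \<and> dist (D \<iota> (fst t) (snd t)) (D \<iota> ub xb) < e'"
    by (intro eventually_ball_finite finite_J ballI)
  then obtain \<rho> where \<rho>: "\<rho> > 0" and near: "\<And>t \<iota>. dist t (ub, xb) < \<rho> \<Longrightarrow> \<iota> \<in> J \<Longrightarrow>
      (F \<iota> ub xb = worst (ub, 0) xb \<or> F \<iota> (fst t) (snd t) < F \<iota>0 (fst t) (snd t))
      \<and> dist (D \<iota> (fst t) (snd t)) (D \<iota> ub xb) < e'"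
    unfolding eventually_nhds_metric by blast
  have near': "(F \<iota> ub xb = worst (ub, 0) xb \<or> F \<iota> v x < F \<iota>0 v x) \<and> dist (D \<iota> v x) (D \<iota> ub xb) < e'"
    if "dist v ub < \<rho> / 2" "dist x xb < \<rho> / 2" "\<iota> \<in> J" for v x \<iota>
  proof -
    have "dist (v, x) (ub, xb) \<le> dist v ub + dist x xb"
      by (simp add: dist_prod_def sqrt_sum_squares_le_sum)
    then show ?thesis using near[of "(v, x)" \<iota>] that by auto
  qed
  \<comment> \<open>With this radius the shifted points \<open>u + \<delta> w\<close> stay within
    \<open>\<rho> / 2\<close> of \<open>ub\<close>, whatever \<open>w \<in> W\<close> is.\<close>
  define d where "d = \<rho> / (2 * (1 + B))"
  have d: "d > 0" "d \<le> \<rho> / 2" "(1 + B) * d = \<rho> / 2"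
    using \<rho> B by (auto simp: d_def field_simps)
  have shift: "norm (u + b *\<^sub>R w) \<le> (1 + B) * norm (u, b)" if "w \<in> W" for u b w
  proof -
    have "norm (u + b *\<^sub>R w) \<le> norm u + \<bar>b\<bar> * norm w"
      by (metis norm_triangle_ineq norm_scaleR)
    also have "\<dots> \<le> norm (u, b) + norm (u, b) * B"
      using norm_fst_le[of u b] norm_snd_le[of b u] B that
      by (intro add_mono mult_mono) auto
    finally show ?thesis by (simp add: algebra_simps)
  qed
  have "\<exists>c\<in>active_grads xb. worst z x - worst z' x \<le> inner c (z - z') + e * norm (z - z')"
    if z: "dist z (ub, 0) < d" and z': "dist z' (ub, 0) < d" and x: "dist x xb < d" for z z' x
  proof -
    obtain \<iota> w where \<iota>: "\<iota> \<in> J" and w: "w \<in> W" and att: "worst z x = F \<iota> (fst z + snd z *\<^sub>R w) x"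
      using worst_attained by blast
    define P where "P y = fst y + snd y *\<^sub>R w" for y :: "'a \<times> real"
    have P: "P y \<in> ball ub (\<rho> / 2)" if "dist y (ub, 0) < d" for y
    proof -
      have "dist (P y) ub = norm ((fst y - ub) + snd y *\<^sub>R w)"
        by (simp add: P_def dist_norm algebra_simps)
      also have "\<dots> \<le> (1 + B) * norm (y - (ub, 0))"
        using shift[OF w, of "fst y - ub" "snd y"] by (cases y) simp
      also have "\<dots> < (1 + B) * d" using that B by (simp add: dist_norm)
      finally show ?thesis by (simp add: d dist_commute)
    qed
    have x': "dist x xb < \<rho> / 2" using x d by simp
    \<comment> \<open>Since \<open>\<iota>\<close> attains the maximum at \<open>(z, x)\<close> with
      direction \<open>w\<close>, it is not strictly below \<open>\<iota>0\<close> at the shifted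
      point \<open>P z\<close>.\<close>
    have act: "F \<iota> ub xb = worst (ub, 0) xb"
      using near'[of "P z" x \<iota>] P[OF z] x' \<iota> worst_upper[OF \<iota>0(1) w, of z x] att
      by (auto simp: P_def dist_commute)
    \<comment> \<open>The mean value theorem is applied on the segment from \<open>P z'\<close> to
      \<open>P z\<close>. Convexity of the ball keeps the segment where the gradient is
      \<open>e'\<close>-close to \<open>D \<iota> ub xb\<close>.\<close>
    define Q where "Q t = P z' + t *\<^sub>R (P z - P z')" for t
    have Q: "Q t \<in> ball ub (\<rho> / 2)" if "0 \<le> t" "t \<le> 1" for t
    proof -
      have "(1 - t) *\<^sub>R P z' + t *\<^sub>R P z \<in> ball ub (\<rho> / 2)"
        by (intro convexD convex_ball P z z') (use that in auto)
      then show ?thesis by (simp add: Q_def algebra_simps)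
    qed
    have der: "((\<lambda>t. F \<iota> (Q t) x) has_derivative (\<lambda>h. inner (h *\<^sub>R (P z - P z')) (D \<iota> (Q t) x))) (at t within S)" for t S
    proof -
      have "(Q has_derivative (\<lambda>h. h *\<^sub>R (P z - P z'))) (at t within S)"
        unfolding Q_def by (auto intro!: derivative_eq_intros)
      moreover have "((\<lambda>v. F \<iota> v x) has_derivative (\<lambda>h. inner h (D \<iota> (Q t) x))) (at (Q t))"
        using gderiv[OF \<iota>] unfolding gderiv_def .
      ultimately show ?thesis by (rule has_derivative_compose)
    qed
    obtain t where "t \<in> {0<..<1}"
      and mv: "F \<iota> (Q 1) x - F \<iota> (Q 0) x = inner (P z - P z') (D \<iota> (Q t) x)"
      using mvt_simple[of 0 1 "\<lambda>t. F \<iota> (Q t) x", OF _ der] by auto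
    then have t: "0 \<le> t" "t \<le> 1" by auto
    define c where "c = (D \<iota> ub xb, inner (D \<iota> ub xb) w)"
    have PP: "P z - P z' = fst (z - z') + snd (z - z') *\<^sub>R w"
      by (simp add: P_def algebra_simps)
    have "worst z x - worst z' x \<le> F \<iota> (P z) x - F \<iota> (P z') x"
      using att worst_upper[OF \<iota> w, of z' x] by (simp add: P_def)
    also have "\<dots> = inner (P z - P z') (D \<iota> (Q t) x)" using mv by (simp add: Q_def)
    also have "\<dots> = inner (P z - P z') (D \<iota> ub xb) + inner (P z - P z') (D \<iota> (Q t) x - D \<iota> ub xb)"
      by (simp add: inner_diff_right)
    \<comment> \<open>The adjoint of the linear map
      \<open>(u, \<delta>) \<mapsto> u + \<delta> w\<close> sends \<open>g\<close> to
      \<open>(g, inner g w)\<close>; here \<open>c\<close> is the image of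
      \<open>D \<iota> ub xb\<close>.\<close>
    also have "inner (P z - P z') (D \<iota> ub xb) = inner c (z - z')"
      unfolding PP c_def by (simp add: inner_prod_def inner_add_right inner_commute)
    also have "inner (P z - P z') (D \<iota> (Q t) x - D \<iota> ub xb) \<le> norm (P z - P z') * e'"
    proof (rule order_trans[OF norm_cauchy_schwarz mult_left_mono])
      show "norm (D \<iota> (Q t) x - D \<iota> ub xb) \<le> e'"
        using near'[of "Q t" x \<iota>] Q[OF t] x' \<iota> by (simp add: dist_commute dist_norm[symmetric])
    qed simp
    also have "norm (P z - P z') * e' \<le> (1 + B) * norm (z - z') * e'"
      using shift[OF w, of "fst (z - z')" "snd (z - z')"] e' unfolding PP prod.collapse
      by (intro mult_right_mono) simp_all
    also have "\<dots> = e * norm (z - z')" using B by (simp add: e'_def)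
    finally have "worst z x - worst z' x \<le> inner c (z - z') + e * norm (z - z')" by simp
    moreover have "c \<in> active_grads xb" using \<iota> w act unfolding c_def active_grads_def by blast
    ultimately show ?thesis by blast
  qed
  then show ?thesis using d(1) by blast
qed

text \<open>Optimality gives \<open>worst (Z j) (xs j) \<le> worst (Z j) y\<close> for every
  competitor \<open>y\<close>. The left side is bounded below by one fixed piece, active at
  \<open>xb\<close>, which converges by continuity. The right side is bounded above by the
  first-order estimate at \<open>y\<close>. The limit compares the values at \<open>xb\<close> and
  \<open>y\<close>.\<close>

lemma minimizers_limit:
  assumes Z: "Z \<longlonglongrightarrow> (ub, 0)" and xs: "\<And>j. xs j \<in> X" "\<And>j. val (Z j) = worst (Z j) (xs j)"
    and lim: "xs \<longlonglongrightarrow> xb"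
  shows "xb \<in> minimizers X (worst (ub, 0))"
proof -
  have xb: "xb \<in> X"
    using closed_sequentially[OF compact_imp_closed[OF compact_X]] xs lim by blast
  have "worst (ub, 0) xb \<le> worst (ub, 0) y" if y: "y \<in> X" for y
  proof -
    obtain \<iota> where \<iota>: "\<iota> \<in> J" "worst (ub, 0) xb = F \<iota> ub xb" using worst_centre_attained by blast
    obtain w where w: "w \<in> W" using W_ne by blast
    obtain d where d: "d > 0" and D: "\<And>z. dist z (ub, 0) < d \<Longrightarrow> \<exists>c\<in>active_grads y.
        worst z y - worst (ub, 0) y \<le> inner c (z - (ub, 0)) + 1 * norm (z - (ub, 0))"
      using worst_diff_le[of 1 y] by (metis dist_self zero_less_one)
    obtain B where B: "\<And>c. c \<in> active_grads y \<Longrightarrow> norm c \<le> B"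
      using compact_imp_bounded[OF compact_active_grads] by (meson bounded_pos)
    have "\<forall>\<^sub>F j in sequentially. F \<iota> (fst (Z j) + snd (Z j) *\<^sub>R w) (xs j)
        \<le> worst (ub, 0) y + (B + 1) * norm (Z j - (ub, 0))"
      using tendstoD[OF Z d]
    proof eventually_elim
      fix j assume "dist (Z j) (ub, 0) < d"
      then obtain c where c: "c \<in> active_grads y"
        "worst (Z j) y - worst (ub, 0) y \<le> inner c (Z j - (ub, 0)) + 1 * norm (Z j - (ub, 0))"
        using D by blast
      have "inner c (Z j - (ub, 0)) \<le> B * norm (Z j - (ub, 0))"
        by (rule order_trans[OF norm_cauchy_schwarz mult_right_mono]) (use B c in auto)
      moreover have "F \<iota> (fst (Z j) + snd (Z j) *\<^sub>R w) (xs j) \<le> worst (Z j) y"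
        using worst_upper[OF \<iota>(1) w, of "Z j" "xs j"] xs(2)[of j] val_le[OF y, of "Z j"] by simp
      ultimately show "F \<iota> (fst (Z j) + snd (Z j) *\<^sub>R w) (xs j)
        \<le> worst (ub, 0) y + (B + 1) * norm (Z j - (ub, 0))"
        using c by (simp add: algebra_simps)
    qed
    moreover have "(\<lambda>j. F \<iota> (fst (Z j) + snd (Z j) *\<^sub>R w) (xs j)) \<longlonglongrightarrow> F \<iota> ub xb"
    proof -
      have "(\<lambda>j. (fst (Z j) + snd (Z j) *\<^sub>R w, xs j)) \<longlonglongrightarrow> (fst (ub, 0::real) + snd (ub, 0::real) *\<^sub>R w, xb)"
        by (intro tendsto_Pair tendsto_add tendsto_scaleR tendsto_fst tendsto_snd tendsto_const Z lim)
      from continuous_on_tendsto_compose[OF cont_F[OF \<iota>(1)] this] show ?thesis by simp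
    qed
    moreover have "(\<lambda>j. worst (ub, 0) y + (B + 1) * norm (Z j - (ub, 0)))
        \<longlonglongrightarrow> worst (ub, 0) y + (B + 1) * norm ((ub, 0) - (ub, 0::real))"
      by (intro tendsto_intros Z)
    ultimately have "F \<iota> ub xb \<le> worst (ub, 0) y + (B + 1) * norm ((ub, 0) - (ub, 0::real))"
      by (intro tendsto_le[OF sequentially_bot]) auto
    then show ?thesis using \<iota>(2) by simp
  qed
  then show ?thesis using xb unfolding minimizers_def by blast
qed

section \<open>Lipschitz modulus and subgradients of the value function\<close>

lemma minimizer_subsequence:
  assumes "Z \<longlonglongrightarrow> (ub, 0)"
  obtains xs \<sigma> xb where "strict_mono (\<sigma> :: nat \<Rightarrow> nat)" "\<And>j. xs j \<in> X"
    "\<And>j. val (Z j) = worst (Z j) (xs j)" "(xs \<circ> \<sigma>) \<longlonglongrightarrow> xb" "xb \<in> minimizers X (worst (ub, 0))"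
proof -
  obtain xs where xs: "\<And>j. xs j \<in> X" "\<And>j. val (Z j) = worst (Z j) (xs j)"
    using val_attained[of "Z _"] by metis
  then obtain xb \<sigma> where \<sigma>: "strict_mono (\<sigma> :: nat \<Rightarrow> nat)" "(xs \<circ> \<sigma>) \<longlonglongrightarrow> xb"
    using compact_X unfolding compact_def by meson
  have "xb \<in> minimizers X (worst (ub, 0))"
    using LIMSEQ_subseq_LIMSEQ[OF assms \<sigma>(1)] xs
    by (intro minimizers_limit[of "Z \<circ> \<sigma>" "xs \<circ> \<sigma>"] \<sigma>) auto
  with \<sigma> xs show ?thesis using that by blast
qed

text \<open>Otherwise there are pairs \<open>Y j\<close>, \<open>Z j\<close> tending to the
  reference point with too large an increment. Freezing \<open>x\<close> at a minimizer for
  \<open>Z j\<close>, the point of smaller value, bounds \<open>val\<close> from above at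
  \<open>Y j\<close> and exactly at \<open>Z j\<close>. Along a subsequence these minimizers tend to
  a nominal minimizer, whose active gradients have norm at most \<open>L\<close>.\<close>

lemma val_lipschitz_near:
  assumes L: "\<And>x c. x \<in> minimizers X (worst (ub, 0)) \<Longrightarrow> c \<in> active_grads x \<Longrightarrow> norm c \<le> L"
    and "e > 0"
  shows "\<exists>d>0. \<forall>z z'. dist z (ub, 0) < d \<longrightarrow> dist z' (ub, 0) < d \<longrightarrow>
     \<bar>val z - val z'\<bar> \<le> (L + e) * dist z z'"
proof (rule ccontr)
  assume "\<not> ?thesis"
  \<comment> \<open>The absolute value is removed by exchanging \<open>z\<close> and
    \<open>z'\<close> if necessary.\<close>
  then have *: "\<exists>z z'. dist z (ub, 0) < d \<and> dist z' (ub, 0) < d \<and>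
      val z - val z' > (L + e) * dist z z'" if "d > 0" for d
    using that by (smt (verit, best) dist_commute)
  have "\<forall>j. \<exists>z z'. dist z (ub, 0) < inverse (real (Suc j)) \<and> dist z' (ub, 0) < inverse (real (Suc j)) \<and>
      val z - val z' > (L + e) * dist z z'"
    by (intro allI *) simp
  then obtain Y Z where Y: "\<And>j. dist (Y j) (ub, 0) < inverse (real (Suc j))"
    and Z: "\<And>j. dist (Z j) (ub, 0) < inverse (real (Suc j))"
    and gt: "\<And>j. val (Y j) - val (Z j) > (L + e) * dist (Y j) (Z j)"
    by metis
  have lim: "V \<longlonglongrightarrow> (ub, 0)" if "\<And>j. dist (V j) (ub, 0) < inverse (real (Suc j))" for V
    by (rule tendsto_dist_iff[THEN iffD2], rule real_tendsto_sandwich[OF _ _ tendsto_const LIMSEQ_inverse_real_of_nat])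
       (use that in \<open>auto intro!: always_eventually less_imp_le\<close>)
  obtain xs \<sigma> xb where \<sigma>: "strict_mono (\<sigma> :: nat \<Rightarrow> nat)" and xs: "\<And>j. xs j \<in> X"
    "\<And>j. val (Z j) = worst (Z j) (xs j)" and xb: "(xs \<circ> \<sigma>) \<longlonglongrightarrow> xb" "xb \<in> minimizers X (worst (ub, 0))"
    using minimizer_subsequence[OF lim[OF Z]] by metis
  obtain d where d: "d > 0" and D: "\<And>z z' x. dist z (ub, 0) < d \<Longrightarrow> dist z' (ub, 0) < d \<Longrightarrow> dist x xb < d \<Longrightarrow>
     \<exists>c\<in>active_grads xb. worst z x - worst z' x \<le> inner c (z - z') + e * norm (z - z')"
    using worst_diff_le[OF \<open>e > 0\<close>, of xb] by metis
  have "\<forall>\<^sub>F j in sequentially. dist ((Y \<circ> \<sigma>) j) (ub, 0) < d \<and> dist ((Z \<circ> \<sigma>) j) (ub, 0) < d \<and> dist ((xs \<circ> \<sigma>) j) xb < d"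
    by (intro eventually_conj tendstoD[OF LIMSEQ_subseq_LIMSEQ[OF lim \<sigma>] d] Y Z tendstoD[OF xb(1) d])
  then obtain j where j: "dist (Y (\<sigma> j)) (ub, 0) < d" "dist (Z (\<sigma> j)) (ub, 0) < d" "dist (xs (\<sigma> j)) xb < d"
    unfolding eventually_sequentially by auto
  let ?y = "Y (\<sigma> j)" and ?z = "Z (\<sigma> j)" and ?x = "xs (\<sigma> j)"
  obtain c where c: "c \<in> active_grads xb"
    "worst ?y ?x - worst ?z ?x \<le> inner c (?y - ?z) + e * norm (?y - ?z)"
    using D[OF j] by blast
  have "inner c (?y - ?z) \<le> L * norm (?y - ?z)"
    by (rule order_trans[OF norm_cauchy_schwarz mult_right_mono]) (use L c xb in auto)
  then have "val ?y - val ?z \<le> (L + e) * dist ?y ?z"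
    using c val_le[OF xs(1), of ?y "\<sigma> j"] xs(2)[of "\<sigma> j"] by (simp add: dist_norm algebra_simps)
  then show False using gt[of "\<sigma> j"] by simp
qed

text \<open>The set of active indices varies with \<open>x\<close>, so the activity condition is
  dropped: for each \<open>\<iota>\<close> the pairs over all of \<open>X \<times> W\<close> form a
  compact set, and finitely many bounds remain.\<close>

lemma active_grads_bounded:
  "\<exists>L. \<forall>x\<in>X. \<forall>c\<in>active_grads x. norm c \<le> L"
proof -
  have "\<exists>b. \<forall>c\<in>(\<lambda>(x, w). (D \<iota> ub x, inner (D \<iota> ub x) w)) ` (X \<times> W). norm c \<le> b" if "\<iota> \<in> J" for \<iota>
  proof -
    have "compact ((\<lambda>t. (D \<iota> ub (fst t), inner (D \<iota> ub (fst t)) (snd t))) ` (X \<times> W))"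
      by (intro compact_continuous_image continuous_intros compact_Times compact_X compact_W that)
    then show ?thesis unfolding split_beta using compact_imp_bounded bounded_iff by blast
  qed
  then obtain b where b: "\<And>\<iota> x w. \<iota> \<in> J \<Longrightarrow> x \<in> X \<Longrightarrow> w \<in> W \<Longrightarrow>
      norm (D \<iota> ub x, inner (D \<iota> ub x) w) \<le> b \<iota>"
    by simp metis
  have "norm c \<le> Max (b ` J)" if c: "x \<in> X" "c \<in> active_grads x" for x c
  proof -
    obtain \<iota> w where "\<iota> \<in> J" "w \<in> W" "c = (D \<iota> ub x, inner (D \<iota> ub x) w)"
      using c unfolding active_grads_def by blast
    then show ?thesis
      using order_trans[OF b[of \<iota> x w] Max_ge[of "b ` J" "b \<iota>"]] c finite_J by blast
  qed
  then show ?thesis by blast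
qed

lemma loc_lip_at_val: "loc_lip_at (\<lambda>z. ereal (val z)) (ub, 0)"
proof -
  obtain L0 where L0: "\<And>x c. x \<in> X \<Longrightarrow> c \<in> active_grads x \<Longrightarrow> norm c \<le> L0"
    using active_grads_bounded by blast
  \<comment> \<open>The maximum with \<open>0\<close> makes the Lipschitz constant
    \<open>L + 1\<close> visibly nonnegative.\<close>
  define L where "L = max L0 0"
  obtain d where d: "d > 0" "\<And>z z'. dist z (ub, 0) < d \<Longrightarrow> dist z' (ub, 0) < d \<Longrightarrow>
     \<bar>val z - val z'\<bar> \<le> (L + 1) * dist z z'"
    using val_lipschitz_near[of L 1] L0 unfolding minimizers_def L_def
    by (metis (no_types, lifting) max.coboundedI1 mem_Collect_eq zero_less_one)
  show ?thesis
    unfolding loc_lip_at_def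
    \<comment> \<open>Halving \<open>d\<close> passes from the open ball to the closed ball required
      by \<open>loc_lip_at\<close>.\<close>
    by (rule exI[of _ "L + 1"], rule conjI, simp add: L_def, rule exI[of _ "d / 2"]) (use d in auto)
qed

lemma lip_mod_val_le:
  assumes "\<And>x c. x \<in> minimizers X (worst (ub, 0)) \<Longrightarrow> c \<in> active_grads x \<Longrightarrow> norm c \<le> L"
  shows "lip_mod (\<lambda>z. ereal (val z)) (ub, 0) \<le> ereal L"
proof (rule ereal_le_epsilon2)
  fix e :: real assume "e > 0"
  then obtain d where d: "d > 0" "\<And>z z'. dist z (ub, 0) < d \<Longrightarrow> dist z' (ub, 0) < d \<Longrightarrow>
     \<bar>val z - val z'\<bar> \<le> (L + e) * dist z z'"
    using val_lipschitz_near[of L e] assms by metis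
  have "\<bar>val z - val z'\<bar> / dist z z' \<le> L + e"
    if "dist (z, z') ((ub, 0), (ub, 0)) < d" "z \<noteq> z'" for z z'
  proof -
    have "dist z (ub, 0) < d" "dist z' (ub, 0) < d"
      using that dist_fst_le[of "(z, z')" "((ub, 0), (ub, 0))"]
        dist_snd_le[of "(z, z')" "((ub, 0), (ub, 0))"] by auto
    then show ?thesis using d(2) that by (simp add: field_simps)
  qed
  then show "lip_mod (\<lambda>z. ereal (val z)) (ub, 0) \<le> ereal L + ereal e"
    unfolding lip_mod_def using d(1)
    by (intro Limsup_bounded) (auto simp: eventually_at intro!: exI[of _ d])
qed

text \<open>At a nearby point, a regular subgradient of the value function is one of the worst-case
  function frozen at a minimiser there. If a limit \<open>V\<close> of such subgradients were outside the hull, the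
  separating direction would contradict the first-order bound above.\<close>

lemma limiting_subdiff_val:
  assumes "V \<in> limiting_subdiff (\<lambda>z. ereal (val z)) (ub, 0)"
  shows "\<exists>xb\<in>minimizers X (worst (ub, 0)). V \<in> convex hull active_grads xb"
proof -
  obtain Z Vs where Z: "Z \<longlonglongrightarrow> (ub, 0)" and Vs: "Vs \<longlonglongrightarrow> V"
    and reg: "\<And>j. regular_subgrad (\<lambda>z. ereal (val z)) (Z j) (Vs j)"
    using assms unfolding limiting_subdiff_def by auto
  obtain xs \<sigma> xb where \<sigma>: "strict_mono (\<sigma> :: nat \<Rightarrow> nat)" and xs: "\<And>j. xs j \<in> X"
    "\<And>j. val (Z j) = worst (Z j) (xs j)" and xb: "(xs \<circ> \<sigma>) \<longlonglongrightarrow> xb" "xb \<in> minimizers X (worst (ub, 0))"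
    using minimizer_subsequence[OF Z] by metis
  have "V \<in> convex hull active_grads xb"
  proof (rule ccontr)
    assume "V \<notin> convex hull active_grads xb"
    then obtain a b where a: "inner a V < b" and ab: "\<And>c. c \<in> convex hull active_grads xb \<Longrightarrow> inner a c > b"
      using separating_hyperplane_closed_point[OF convex_convex_hull
          compact_imp_closed[OF compact_convex_hull[OF compact_active_grads]]] by metis
    \<comment> \<open>Letting \<open>e\<close> tend to \<open>0\<close> contradicts
      \<open>inner a V < b\<close>.\<close>
    have "b \<le> inner a V + e" if e: "e > 0" for e
    proof -
      \<comment> \<open>One error \<open>e'\<close> comes from the subgradient inequality and one
        from the first-order bound, each multiplied by \<open>norm a\<close> after division by the
        step length.\<close>
      define e' where "e' = e / (2 * (norm a + 1))"
      have e': "e' > 0" "2 * e' * norm a \<le> e"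
        using e by (auto simp: e'_def divide_simps add_pos_nonneg add_nonneg_pos)
      obtain d where d: "d > 0" and D: "\<And>z z' x. dist z (ub, 0) < d \<Longrightarrow> dist z' (ub, 0) < d \<Longrightarrow> dist x xb < d \<Longrightarrow>
         \<exists>c\<in>active_grads xb. worst z x - worst z' x \<le> inner c (z - z') + e' * norm (z - z')"
        using worst_diff_le[OF e'(1), of xb] by metis
      have "b \<le> inner a (Vs j) + e" if j: "dist (Z j) (ub, 0) < d" "dist (xs j) xb < d" for j
      proof -
        obtain d' where d': "d' > 0" and R: "\<And>z. dist z (Z j) < d' \<Longrightarrow>
            val (Z j) + inner (Vs j) (z - Z j) - e' * norm (z - Z j) \<le> val z"
          using reg[of j] e' unfolding regular_subgrad_def by auto
        \<comment> \<open>The step is short enough to stay both in the neighbourhood of the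
          subgradient inequality at \<open>Z j\<close> and within \<open>d\<close> of the reference
          point. Adding \<open>1\<close> keeps the denominator positive.\<close>
        define t where "t = min d' (d - dist (Z j) (ub, 0)) / (norm a + 1)"
        have t: "t > 0" using d' j by (simp add: t_def add_nonneg_pos)
        have "t * norm a < t * (norm a + 1)" using t by simp
        also have "\<dots> = min d' (d - dist (Z j) (ub, 0))"
          by (simp add: t_def add_nonneg_pos less_imp_neq[symmetric] add_nonneg_eq_0_iff)
        finally have ta: "t * norm a < d'" "t * norm a + dist (Z j) (ub, 0) < d" by auto
        \<comment> \<open>Moving along \<open>- a\<close> reverses signs: comparing the two bounds
          on \<open>val z\<close> bounds \<open>inner a c\<close> from above by
          \<open>inner a (Vs j)\<close> plus the error, while separation gives
          \<open>b < inner a c\<close>.\<close>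
        define z where "z = Z j - t *\<^sub>R a"
        have z: "z - Z j = - (t *\<^sub>R a)" "norm (z - Z j) = t * norm a" "dist z (Z j) < d'"
          using t ta by (auto simp: z_def dist_norm)
        have "dist z (ub, 0) < d"
          using dist_triangle[of z "(ub, 0)" "Z j"] ta(2) unfolding dist_norm[of z "Z j"] z(2) by linarith
        then obtain c where c: "c \<in> active_grads xb"
          "worst z (xs j) - worst (Z j) (xs j) \<le> inner c (z - Z j) + e' * norm (z - Z j)"
          using D j by blast
        have "val (Z j) + inner (Vs j) (z - Z j) - e' * norm (z - Z j)
            \<le> val (Z j) + inner c (z - Z j) + e' * norm (z - Z j)"
          using R[OF z(3)] val_le[OF xs(1), of z j] c(2) xs(2)[of j] by simp
        then have "t * inner a c \<le> t * (inner a (Vs j) + 2 * e' * norm a)"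
          unfolding z(2) unfolding z(1) by (simp add: algebra_simps inner_commute)
        then have "inner a c \<le> inner a (Vs j) + 2 * e' * norm a" using t by simp
        moreover have "b < inner a c" using ab[OF hull_inc[OF c(1)]] .
        ultimately show ?thesis using e' by simp
      qed
      moreover have "\<forall>\<^sub>F j in sequentially. dist ((Z \<circ> \<sigma>) j) (ub, 0) < d \<and> dist ((xs \<circ> \<sigma>) j) xb < d"
        by (intro eventually_conj tendstoD[OF LIMSEQ_subseq_LIMSEQ[OF Z \<sigma>] d] tendstoD[OF xb(1) d])
      ultimately have "\<forall>\<^sub>F j in sequentially. b \<le> inner a ((Vs \<circ> \<sigma>) j) + e"
        by (auto elim: eventually_mono)
      moreover have "(\<lambda>j. inner a ((Vs \<circ> \<sigma>) j) + e) \<longlonglongrightarrow> inner a V + e"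
        by (intro tendsto_intros LIMSEQ_subseq_LIMSEQ[OF Vs \<sigma>])
      ultimately show ?thesis
        by (intro tendsto_lowerbound) auto
    qed
    then show False using a by (meson field_le_epsilon not_le)
  qed
  then show ?thesis using xb by blast
qed

end

section \<open>Norms on subspaces\<close>

lemma is_norm_onD:
  assumes "is_norm_on S N" "v \<in> S"
  shows "0 \<le> N v" "N v = 0 \<longleftrightarrow> v = 0" "N (a *\<^sub>R v) = \<bar>a\<bar> * N v" "w \<in> S \<Longrightarrow> N (v + w) \<le> N v + N w"
  using assms unfolding is_norm_on_def by auto

lemma is_norm_on_sum_le:
  assumes "subspace S" "is_norm_on S N" "finite B" "B \<subseteq> S"
  shows "N (\<Sum>b\<in>B. a b *\<^sub>R b) \<le> (\<Sum>b\<in>B. \<bar>a b\<bar> * N b)"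
  using assms(3,4)
proof (induction B rule: finite_induct)
  case empty
  then show ?case using is_norm_onD(2)[OF assms(2) subspace_0[OF assms(1)]] by simp
next
  case (insert b B)
  have "N (a b *\<^sub>R b + (\<Sum>b\<in>B. a b *\<^sub>R b)) \<le> N (a b *\<^sub>R b) + N (\<Sum>b\<in>B. a b *\<^sub>R b)"
    using insert.prems assms(1)
    by (intro is_norm_onD[OF assms(2)] subspace_scale subspace_sum) auto
  then show ?case using insert is_norm_onD(3)[OF assms(2), of b "a b"] by simp
qed

text \<open>Expansion in an orthonormal basis of \<open>S\<close> bounds \<open>N\<close> by
  \<open>C\<close> times the Euclidean norm, and the reverse triangle inequality then makes
  \<open>N\<close> Lipschitz with constant \<open>C\<close>.\<close>

lemma is_norm_on_continuous:
  fixes S :: "'a::euclidean_space set"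
  assumes S: "subspace S" and N: "is_norm_on S N"
  shows "continuous_on S N"
proof -
  obtain B where B: "B \<subseteq> S" "pairwise orthogonal B" "\<And>x. x \<in> B \<Longrightarrow> norm x = 1" "independent B" "span B = S"
    using orthonormal_basis_subspace[OF S] by metis
  have fB: "finite B" using B(4) by (rule independent_imp_finite)
  define C where "C = (\<Sum>b\<in>B. N b)"
  have le: "N v \<le> C * norm v" if "v \<in> S" for v
  proof -
    have "N v = N (\<Sum>b\<in>B. inner v b *\<^sub>R b)"
      using orthonormal_basis_expand[OF B(2,3) _ fB, of v] B(5) that by simp
    also have "\<dots> \<le> (\<Sum>b\<in>B. \<bar>inner v b\<bar> * N b)"
      using is_norm_on_sum_le[OF S N fB B(1)] .
    also have "\<dots> \<le> (\<Sum>b\<in>B. norm v * N b)"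
    proof (intro sum_mono mult_right_mono)
      fix b assume b: "b \<in> B"
      show "\<bar>inner v b\<bar> \<le> norm v" using Cauchy_Schwarz_ineq2[of v b] B(3)[OF b] by simp
      show "0 \<le> N b" using is_norm_onD(1)[OF N] b B(1) by blast
    qed
    finally show ?thesis by (simp add: C_def sum_distrib_left mult.commute)
  qed
  have diff: "\<bar>N v - N w\<bar> \<le> C * dist v w" if v: "v \<in> S" and w: "w \<in> S" for v w
  proof -
    have *: "N v \<le> N w + C * dist v w" if "v \<in> S" "w \<in> S" for v w
      using is_norm_onD(4)[OF N, of w "v - w"] le[of "v - w"] that S
      by (simp add: dist_norm subspace_diff)
    from *[OF v w] *[OF w v] show ?thesis by (simp add: dist_commute)
  qed
  have C: "C \<ge> 0" unfolding C_def using is_norm_onD(1)[OF N] B(1) by (intro sum_nonneg) auto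
  show ?thesis
  proof (rule lipschitz_on_continuous_on)
    show "C-lipschitz_on S N" using diff C by (auto simp: lipschitz_on_def dist_real_def)
  qed
qed

text \<open>By continuity and definiteness \<open>N\<close> has a positive minimum on the Euclidean
  unit sphere of \<open>S\<close>; homogeneity carries the bound to all of \<open>S\<close>.\<close>

lemma is_norm_on_equiv:
  fixes S :: "'a::euclidean_space set"
  assumes S: "subspace S" and N: "is_norm_on S N"
  shows "\<exists>c\<ge>0. \<forall>v\<in>S. norm v \<le> c * N v"
proof (cases "S \<inter> sphere 0 1 = {}")
  \<comment> \<open>Here \<open>S\<close> is trivial, as happens for a block without
    coordinates.\<close>
  case True
  have "v = 0" if "v \<in> S" for v
  proof (rule ccontr)
    assume "v \<noteq> 0"
    then have "(1 / norm v) *\<^sub>R v \<in> S \<inter> sphere 0 1" using that S by (simp add: subspace_scale)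
    with True show False by blast
  qed
  then show ?thesis by (intro exI[of _ 0]) auto
next
  case False
  have "compact (S \<inter> sphere 0 1)" using S by (intro closed_Int_compact closed_subspace) auto
  moreover have "continuous_on (S \<inter> sphere 0 1) N"
    using is_norm_on_continuous[OF S N] by (rule continuous_on_subset) blast
  ultimately obtain m where "m \<in> S \<inter> sphere 0 1" "\<And>v. v \<in> S \<inter> sphere 0 1 \<Longrightarrow> N m \<le> N v"
    using continuous_attains_inf[of "S \<inter> sphere 0 1" N] False by blast
  then have m: "m \<in> S" "norm m = 1" "\<And>v. v \<in> S \<Longrightarrow> norm v = 1 \<Longrightarrow> N m \<le> N v"
    by auto
  have pos: "N m > 0" using is_norm_onD(1,2)[OF N m(1)] m(2) by (auto simp: less_le)
  have "norm v \<le> (1 / N m) * N v" if "v \<in> S" for v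
  proof (cases "v = 0")
    case False
    have "N m \<le> N ((1 / norm v) *\<^sub>R v)" using m(3) that S False by (simp add: subspace_scale)
    also have "\<dots> = N v / norm v" using is_norm_onD(3)[OF N that] by simp
    finally show ?thesis using pos False by (simp add: field_simps)
  qed (use is_norm_onD[OF N that] pos in simp)
  then show ?thesis using pos by (intro exI[of _ "1 / N m"]) auto
qed

text \<open>Norm equivalence gives boundedness and continuity gives closedness. Convexity will allow
  directions to be averaged within one block.\<close>

lemma is_norm_on_unit_ball:
  fixes S :: "'a::euclidean_space set"
  assumes S: "subspace S" and N: "is_norm_on S N"
  shows compact_unit_ball_on: "compact {v\<in>S. N v \<le> 1}"
    and convex_unit_ball_on: "convex {v\<in>S. N v \<le> 1}"
proof -
  obtain c where c: "c \<ge> 0" "\<And>v. v \<in> S \<Longrightarrow> norm v \<le> c * N v" using is_norm_on_equiv[OF S N] by blast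
  have "norm v \<le> c" if "v \<in> S" "N v \<le> 1" for v
    using c(2)[OF that(1)] mult_left_mono[OF that(2) c(1)] by simp
  then have "bounded {v\<in>S. N v \<le> 1}" unfolding bounded_iff by blast
  moreover have "closed {v\<in>S. N v \<le> 1}"
    using S by (intro continuous_on_closed_Collect_le is_norm_on_continuous[OF S N] closed_subspace) auto
  ultimately show "compact {v\<in>S. N v \<le> 1}" by (simp add: compact_eq_bounded_closed)
  show "convex {v\<in>S. N v \<le> 1}"
  proof (rule convexI)
    fix x y and a b :: real
    assume *: "x \<in> {v\<in>S. N v \<le> 1}" "y \<in> {v\<in>S. N v \<le> 1}" "0 \<le> a" "0 \<le> b" "a + b = 1"
    have "N (a *\<^sub>R x + b *\<^sub>R y) \<le> N (a *\<^sub>R x) + N (b *\<^sub>R y)"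
      using * S by (intro is_norm_onD[OF N] subspace_scale) auto
    also have "\<dots> = a * N x + b * N y" using * is_norm_onD(3)[OF N] by simp
    also have "\<dots> \<le> a * 1 + b * 1" using * by (intro add_mono mult_left_mono) auto
    finally show "a *\<^sub>R x + b *\<^sub>R y \<in> {v\<in>S. N v \<le> 1}"
      using * S by (simp add: subspace_add subspace_scale)
  qed
qed

section \<open>Block coordinates and partial gradients\<close>

lemma subspace_block_space: "subspace (block_space blk k)"
  by (auto simp: subspace_def block_space_def)

lemma blockpart_in [simp]: "blockpart blk k v \<in> block_space blk k"
  by (simp add: blockpart_def block_space_def)

lemma linear_blockpart: "linear (blockpart blk k :: real^'m \<Rightarrow> real^'m)"
  by (rule linearI) (auto simp: blockpart_def vec_eq_iff)

lemma inner_blockpart: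
  assumes "g \<in> block_space blk k"
  shows "inner g (blockpart blk k v) = inner g v"
  unfolding inner_vec_def using assms
  by (intro sum.cong) (auto simp: blockpart_def block_space_def)

lemma blockpart_self_adjoint: "inner (blockpart blk k v) w = inner v (blockpart blk k w)"
  unfolding inner_vec_def by (intro sum.cong) (auto simp: blockpart_def)

lemma sum_blockpart:
  assumes "\<forall>j. blk j \<in> {1..s}"
  shows "(\<Sum>k=1..s. blockpart blk k v) = v"
  using assms by (simp add: vec_eq_iff blockpart_def)

text \<open>Uniqueness of derivatives makes the definite description in \<open>grad1\<close> well
  defined.\<close>

lemma grad1_eqI:
  assumes "GDERIV (\<lambda>v. F v x) u :> g"
  shows "grad1 F u x = g"
  unfolding grad1_def
proof (rule the_equality)
  show "GDERIV (\<lambda>v. F v x) u :> g" by (rule assms)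
  fix g' assume "GDERIV (\<lambda>v. F v x) u :> g'"
  then have "(\<lambda>h. inner h g') = (\<lambda>h. inner h g)"
    using assms unfolding gderiv_def by (rule has_derivative_unique)
  then show "g' = g" by (metis inner_commute vector_eq_rdot)
qed

text \<open>The partial derivative is the joint one restricted to directions \<open>(h, 0)\<close>.
  \<open>G\<close> is the Riesz representative of this functional, written in coordinates, so it
  inherits joint continuity from \<open>F'\<close>.\<close>

lemma C1_fun_partial_gradient:
  fixes F :: "real^'m \<Rightarrow> 'b::real_normed_vector \<Rightarrow> real"
  assumes "C1_fun (\<lambda>(v, x). F v x)"
  shows C1_fun_GDERIV: "GDERIV (\<lambda>v. F v x) v :> grad1 F v x"
    and C1_fun_continuous_grad1: "continuous_on UNIV (\<lambda>(v, x). grad1 F v x)"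
    and C1_fun_continuous: "continuous_on UNIV (\<lambda>(v, x). F v x)"
proof -
  obtain F' where F': "\<And>z. ((\<lambda>(v, x). F v x) has_derivative blinfun_apply (F' z)) (at z)"
    and cont: "continuous_on UNIV F'"
    using assms unfolding C1_fun_def by blast
  define G where "G z = (\<Sum>b\<in>Basis. blinfun_apply (F' z) (b, 0) *\<^sub>R b)" for z
  have G: "GDERIV (\<lambda>v. F v x) v :> G (v, x)" for v x
  proof -
    have "((\<lambda>v. (v, x)) has_derivative (\<lambda>h. (h, 0))) (at v)"
      by (auto intro!: derivative_eq_intros)
    then have "((\<lambda>v. F v x) has_derivative (\<lambda>h. blinfun_apply (F' (v, x)) (h, 0))) (at v)"
      using has_derivative_compose[of "\<lambda>v. (v, x)" "\<lambda>h. (h, 0)" v UNIV "\<lambda>(v, x). F v x"] F' by simp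
    moreover have "blinfun_apply (F' (v, x)) (h, 0) = inner h (G (v, x))" for h
    proof -
      have "linear (\<lambda>h. blinfun_apply (F' (v, x)) (h, 0))"
        by (intro linearI) (simp_all flip: blinfun.add_right blinfun.scaleR_right real_scaleR_def)
      then have "blinfun_apply (F' (v, x)) ((\<Sum>b\<in>Basis. inner h b *\<^sub>R b), 0) =
          (\<Sum>b\<in>Basis. inner h b *\<^sub>R blinfun_apply (F' (v, x)) (b, 0))"
        using linear_sum[of "\<lambda>h. blinfun_apply (F' (v, x)) (h, 0)" "\<lambda>b. inner h b *\<^sub>R b" Basis]
          linear_cmul[of "\<lambda>h. blinfun_apply (F' (v, x)) (h, 0)"] by simp
      then show ?thesis
        by (simp add: euclidean_representation G_def inner_sum_right mult.commute)
    qed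
    ultimately show ?thesis unfolding gderiv_def by simp
  qed
  have G_eq: "grad1 F v x = G (v, x)" for v x using grad1_eqI[of F x, OF G] .
  show "GDERIV (\<lambda>v. F v x) v :> grad1 F v x" unfolding G_eq by (rule G)
  have "continuous_on UNIV G"
    unfolding G_def by (intro continuous_intros cont)
  then show "continuous_on UNIV (\<lambda>(v, x). grad1 F v x)" unfolding G_eq by simp
  show "continuous_on UNIV (\<lambda>(v, x). F v x)"
    using F' by (intro has_derivative_continuous_on) (auto intro: has_derivative_at_withinI)
qed

text \<open>Differentiating \<open>F v x = F (blockpart blk k v) x\<close> by the chain rule and
  using that the projection is self-adjoint exhibits the gradient as a projected vector.\<close>

lemma grad1_in_block_space:
  fixes F :: "real^'m \<Rightarrow> 'b::real_normed_vector \<Rightarrow> real"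
  assumes C1: "C1_fun (\<lambda>(v, x). F v x)" and dep: "\<And>v x. F v x = F (blockpart blk k v) x"
  shows "grad1 F v x \<in> block_space blk k"
proof -
  have "(blockpart blk k has_derivative blockpart blk k) (at v)"
    by (intro linear_imp_has_derivative linear_blockpart)
  then have "((\<lambda>v. F (blockpart blk k v) x) has_derivative
      (\<lambda>h. inner (blockpart blk k h) (grad1 F (blockpart blk k v) x))) (at v)"
    using C1_fun_GDERIV[OF C1, of x "blockpart blk k v"] unfolding gderiv_def
    by (rule has_derivative_compose)
  then have "GDERIV (\<lambda>v. F v x) v :> blockpart blk k (grad1 F (blockpart blk k v) x)"
    unfolding gderiv_def blockpart_self_adjoint dep[symmetric] .
  then show ?thesis using grad1_eqI[of F x] by (metis blockpart_in)
qed

lemma loc_lip_continuous_on: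
  fixes f0 :: "'a::metric_space \<Rightarrow> real"
  assumes "loc_lip (\<lambda>x. ereal (f0 x))"
  shows "continuous_on S f0"
proof (rule continuous_at_imp_continuous_on, intro ballI)
  fix x
  obtain \<kappa> e where \<kappa>: "\<kappa> \<ge> 0" and e: "e > 0"
    and lip: "\<And>y. dist y x \<le> e \<Longrightarrow> \<bar>f0 y - f0 x\<bar> \<le> \<kappa> * dist y x"
  proof -
    have "loc_lip_at (\<lambda>x. ereal (f0 x)) x" using assms unfolding loc_lip_def by blast
    then obtain \<kappa> e where "\<kappa> \<ge> 0" "e > 0" and
      "\<And>y y'. dist y x \<le> e \<Longrightarrow> dist y' x \<le> e \<Longrightarrow> \<bar>f0 y - f0 y'\<bar> \<le> \<kappa> * dist y y'"
      unfolding loc_lip_at_def by auto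
    then show thesis by (intro that[of \<kappa> e]) auto
  qed
  have "(f0 \<longlongrightarrow> f0 x) (at x)"
  proof (rule tendsto_dist_iff[THEN iffD2], rule real_tendsto_sandwich[OF _ _ tendsto_const])
    show "\<forall>\<^sub>F y in at x. dist (f0 y) (f0 x) \<le> \<kappa> * dist y x"
      using e lip by (auto simp: eventually_at dist_real_def intro!: exI[of _ e])
    have "((\<lambda>y. \<kappa> * dist y x) \<longlongrightarrow> \<kappa> * dist x x) (at x)" by (intro tendsto_intros)
    then show "((\<lambda>y. \<kappa> * dist y x) \<longlongrightarrow> 0) (at x)" by simp
  qed simp
  then show "isCont f0 x" by (simp add: isCont_def)
qed

section \<open>The robust problem\<close>

locale robust_problem =
  fixes f0 :: "real^'n \<Rightarrow> real"
    and X :: "(real^'n) set"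
    and s :: nat
    and r :: "nat \<Rightarrow> nat"
    and f :: "nat \<Rightarrow> nat \<Rightarrow> real^'m \<Rightarrow> real^'n \<Rightarrow> real"
    and blk :: "'m \<Rightarrow> nat"
    and nrm :: "nat \<Rightarrow> real^'m \<Rightarrow> real"
    and ub :: "real^'m"
  assumes f0_lip: "loc_lip (\<lambda>x. ereal (f0 x))"
    and X_compact: "compact X" and X_nonempty: "X \<noteq> {}"
    and blk_range: "\<forall>j. blk j \<in> {1..s}"
    and r_pos: "\<forall>k\<in>{1..s}. 1 \<le> r k"
    and f_block: "\<forall>k\<in>{1..s}. \<forall>i\<in>{1..r k}. \<forall>v x. f k i v x = f k i (blockpart blk k v) x"
    and f_C1: "\<forall>k\<in>{1..s}. \<forall>i\<in>{1..r k}. C1_fun (\<lambda>(v, x). f k i v x)"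
    and nrm_norm: "\<forall>k\<in>{1..s}. is_norm_on (block_space blk k) (nrm k)"
begin

text \<open>The extensional product is taken because it is finite: values outside the blocks are
  fixed.\<close>

definition selections :: "(nat \<Rightarrow> nat) set" where
  "selections = (\<Pi>\<^sub>E k\<in>{1..s}. {1..r k})"

definition unit_box :: "(real^'m) set" where
  "unit_box = {w. \<forall>k\<in>{1..s}. nrm k (blockpart blk k w) \<le> 1}"

definition piece :: "(nat \<Rightarrow> nat) \<Rightarrow> real^'m \<Rightarrow> real^'n \<Rightarrow> real" where
  "piece \<iota> v x = f0 x + (\<Sum>k=1..s. f k (\<iota> k) v x)"

definition piece_grad :: "(nat \<Rightarrow> nat) \<Rightarrow> real^'m \<Rightarrow> real^'n \<Rightarrow> real^'m" where
  "piece_grad \<iota> v x = (\<Sum>k=1..s. grad1 (f k (\<iota> k)) v x)"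

lemma blocks_nonempty: "{1..s} \<noteq> {}"
  using blk_range by blast

lemma selectionsD: "\<iota> \<in> selections \<Longrightarrow> k \<in> {1..s} \<Longrightarrow> \<iota> k \<in> {1..r k}"
  unfolding selections_def by auto

lemma grad1_block: "k \<in> {1..s} \<Longrightarrow> i \<in> {1..r k} \<Longrightarrow> grad1 (f k i) v x \<in> block_space blk k"
  using f_C1 f_block by (intro grad1_in_block_space) blast+

lemma nrm_zero: "k \<in> {1..s} \<Longrightarrow> nrm k 0 = 0"
  using nrm_norm is_norm_onD(2)[of "block_space blk k" "nrm k" 0] subspace_0[OF subspace_block_space]
  by blast

lemma block_ball_compact: "k \<in> {1..s} \<Longrightarrow> compact {w \<in> block_space blk k. nrm k w \<le> 1}"
  using compact_unit_ball_on[OF subspace_block_space] nrm_norm by blast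

lemma zero_in_unit_box: "0 \<in> unit_box"
  using nrm_zero by (auto simp: unit_box_def linear_0[OF linear_blockpart])

text \<open>The box is an intersection of preimages of closed block balls under linear projections,
  and each vector is the sum of its block parts, which are bounded.\<close>

lemma compact_unit_box: "compact unit_box"
proof -
  let ?B = "\<lambda>k. {w \<in> block_space blk k. nrm k w \<le> 1}"
  have "unit_box = (\<Inter>k\<in>{1..s}. blockpart blk k -` ?B k)"
    by (auto simp: unit_box_def)
  moreover have "closed (blockpart blk k -` ?B k)" if "k \<in> {1..s}" for k
    using block_ball_compact[OF that]
    by (intro continuous_closed_vimage linear_continuous_at compact_imp_closed)
      (auto simp: linear_blockpart linear_linear)
  ultimately have "closed unit_box" by (simp add: closed_INT)
  moreover have "bounded unit_box"
  proof -
    have "\<exists>b. \<forall>w\<in>?B k. norm w \<le> b" if "k \<in> {1..s}" for k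
      using compact_imp_bounded[OF block_ball_compact[OF that]] unfolding bounded_iff .
    then obtain b where b: "\<And>k w. k \<in> {1..s} \<Longrightarrow> w \<in> ?B k \<Longrightarrow> norm w \<le> b k"
      using bchoice[of "{1..s}" "\<lambda>k b. \<forall>w\<in>?B k. norm w \<le> b"] by blast
    have "norm w \<le> (\<Sum>k=1..s. b k)" if w: "w \<in> unit_box" for w
    proof -
      have "norm (\<Sum>k=1..s. blockpart blk k w) \<le> (\<Sum>k=1..s. b k)"
        using w by (intro sum_norm_le b) (auto simp: unit_box_def)
      then show ?thesis by (simp only: sum_blockpart[OF blk_range])
    qed
    then show ?thesis unfolding bounded_iff by blast
  qed
  ultimately show ?thesis by (simp add: compact_eq_bounded_closed)
qed

text \<open>\<open>f0\<close> is constant in \<open>v\<close>: it enters the joint continuity of the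
  pieces and contributes nothing to their gradients in \<open>v\<close>.\<close>

sublocale minmax_family piece piece_grad selections unit_box X ub
proof
  show "finite selections" unfolding selections_def by (intro finite_PiE) auto
  show "selections \<noteq> {}" unfolding selections_def using r_pos by (simp add: PiE_eq_empty_iff)
  show "compact unit_box" by (rule compact_unit_box)
  show "unit_box \<noteq> {}" using zero_in_unit_box by blast
  show "compact X" "X \<noteq> {}" by (rule X_compact X_nonempty)+
  fix \<iota> assume \<iota>: "\<iota> \<in> selections"
  have C1: "C1_fun (\<lambda>(v, x). f k (\<iota> k) v x)" if "k \<in> {1..s}" for k
    using f_C1 selectionsD[OF \<iota> that] that by blast
  have "continuous_on UNIV (\<lambda>z. f0 (snd z))"
    by (rule continuous_on_compose2[OF loc_lip_continuous_on[OF f0_lip, of UNIV]])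
      (auto intro: continuous_intros)
  moreover have "continuous_on UNIV (\<lambda>z. f k (\<iota> k) (fst z) (snd z))" if "k \<in> {1..s}" for k
    using C1_fun_continuous[OF C1[OF that]] by (simp add: split_beta)
  ultimately show "continuous_on UNIV (\<lambda>(v, x). piece \<iota> v x)"
    unfolding piece_def split_beta by (intro continuous_on_add continuous_on_sum)
  have "continuous_on UNIV (\<lambda>z. grad1 (f k (\<iota> k)) (fst z) (snd z))" if "k \<in> {1..s}" for k
    using C1_fun_continuous_grad1[OF C1[OF that]] by (simp add: split_beta)
  then show "continuous_on UNIV (\<lambda>(v, x). piece_grad \<iota> v x)"
    unfolding piece_grad_def split_beta by (intro continuous_on_sum)
  show "GDERIV (\<lambda>v. piece \<iota> v x) v :> piece_grad \<iota> v x" for x v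
  proof -
    have "((\<lambda>v. \<Sum>k=1..s. f k (\<iota> k) v x) has_derivative
        (\<lambda>h. \<Sum>k=1..s. inner h (grad1 (f k (\<iota> k)) v x))) (at v)"
      using C1_fun_GDERIV[OF C1] unfolding gderiv_def by (intro has_derivative_sum)
    then show ?thesis
      unfolding gderiv_def piece_def piece_grad_def inner_sum_right
      by (auto simp only: add_0_left dest: has_derivative_add[OF has_derivative_const[of "f0 x"]])
  qed
qed

text \<open>For \<open>\<delta> \<noteq> 0\<close> this is division by \<open>\<delta>\<close>,
  whose sign disappears by homogeneity and the absolute value in \<open>Uset\<close>. For
  \<open>\<delta> = 0\<close> definiteness of the block norms leaves only \<open>u\<close> on both
  sides.\<close>

lemma Uset_eq: "Uset blk s nrm u \<delta> = (\<lambda>w. u + \<delta> *\<^sub>R w) ` unit_box"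
proof -
  have Max_le: "v \<in> Uset blk s nrm u \<delta> \<longleftrightarrow> (\<forall>k\<in>{1..s}. nrm k (blockpart blk k (v - u)) \<le> \<bar>\<delta>\<bar>)" for v
    unfolding Uset_def using blocks_nonempty by (subst mem_Collect_eq, subst Max_le_iff) auto
  have scale: "nrm k (blockpart blk k (a *\<^sub>R w)) = \<bar>a\<bar> * nrm k (blockpart blk k w)" if "k \<in> {1..s}" for k a w
    using that nrm_norm is_norm_onD(3)[OF _ blockpart_in] linear_cmul[OF linear_blockpart] by metis
  show ?thesis
  proof (intro set_eqI iffI)
    fix v assume "v \<in> (\<lambda>w. u + \<delta> *\<^sub>R w) ` unit_box"
    then obtain w where w: "w \<in> unit_box" "v = u + \<delta> *\<^sub>R w" by blast
    then show "v \<in> Uset blk s nrm u \<delta>"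
      unfolding Max_le by (auto simp: scale unit_box_def mult_left_le)
  next
    fix v assume v: "v \<in> Uset blk s nrm u \<delta>"
    show "v \<in> (\<lambda>w. u + \<delta> *\<^sub>R w) ` unit_box"
    proof (cases "\<delta> = 0")
      case True
      have "blockpart blk k (v - u) = 0" if k: "k \<in> {1..s}" for k
        using v[unfolded Max_le] True k nrm_norm is_norm_onD(1,2)[OF _ blockpart_in, of blk k "nrm k" "v - u"]
        by fastforce
      then have "v - u = 0" using sum_blockpart[OF blk_range, of "v - u"] by simp
      then show ?thesis using True zero_in_unit_box by auto
    next
      case False
      have "(1 / \<delta>) *\<^sub>R (v - u) \<in> unit_box"
        using v[unfolded Max_le] False by (auto simp: unit_box_def scale divide_le_eq_1)
      moreover have "v = u + \<delta> *\<^sub>R ((1 / \<delta>) *\<^sub>R (v - u))" using False by simp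
      ultimately show ?thesis by blast
    qed
  qed
qed

section \<open>The objective as a maximum over selections\<close>

lemma piece_le_objective: "\<iota> \<in> selections \<Longrightarrow> piece \<iota> v x \<le> objective f0 s r f v x"
  unfolding piece_def objective_def
  by (intro add_left_mono sum_mono Max_ge) (auto dest: selectionsD)

lemma objective_attained: "\<exists>\<iota>\<in>selections. objective f0 s r f v x = piece \<iota> v x"
proof -
  have "\<exists>i\<in>{1..r k}. Max ((\<lambda>i. f k i v x) ` {1..r k}) = f k i v x" if "k \<in> {1..s}" for k
    using Max_in[of "(\<lambda>i. f k i v x) ` {1..r k}"] r_pos that by fastforce
  then obtain \<iota> where \<iota>: "\<And>k. k \<in> {1..s} \<Longrightarrow> \<iota> k \<in> {1..r k}"
      "\<And>k. k \<in> {1..s} \<Longrightarrow> Max ((\<lambda>i. f k i v x) ` {1..r k}) = f k (\<iota> k) v x" by metis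
  have "restrict \<iota> {1..s} \<in> selections" unfolding selections_def using \<iota>(1) by auto
  moreover have "objective f0 s r f v x = piece (restrict \<iota> {1..s}) v x"
    unfolding objective_def piece_def using \<iota>(2) by simp
  ultimately show ?thesis by blast
qed

text \<open>Both extended-real bounds are attained, so the min-value function is real-valued
  everywhere and the results on \<open>val\<close> apply to it.\<close>

lemma minval_eq: "minval blk s nrm f0 X r f = (\<lambda>z. ereal (val z))"
proof
  fix z
  have SUP: "(SUP v\<in>Uset blk s nrm (fst z) (snd z). ereal (objective f0 s r f v x)) = ereal (worst z x)" for x
  proof (rule antisym)
    show "(SUP v\<in>Uset blk s nrm (fst z) (snd z). ereal (objective f0 s r f v x)) \<le> ereal (worst z x)"
    proof (rule SUP_least)
      fix v assume "v \<in> Uset blk s nrm (fst z) (snd z)"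
      then obtain w where w: "w \<in> unit_box" "v = fst z + snd z *\<^sub>R w" unfolding Uset_eq by blast
      obtain \<iota> where "\<iota> \<in> selections" "objective f0 s r f v x = piece \<iota> v x" using objective_attained by blast
      then show "ereal (objective f0 s r f v x) \<le> ereal (worst z x)"
        using worst_upper[of \<iota> w z x] w by simp
    qed
    obtain \<iota> w where "\<iota> \<in> selections" "w \<in> unit_box" "worst z x = piece \<iota> (fst z + snd z *\<^sub>R w) x"
      using worst_attained by blast
    then show "ereal (worst z x) \<le> (SUP v\<in>Uset blk s nrm (fst z) (snd z). ereal (objective f0 s r f v x))"
      unfolding Uset_eq
      by (intro SUP_upper2[of "fst z + snd z *\<^sub>R w"]) (auto intro: piece_le_objective)
  qed
  obtain x0 where "x0 \<in> X" "val z = worst z x0" using val_attained by blast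
  then show "minval blk s nrm f0 X r f z = ereal (val z)"
    unfolding minval_def SUP
    using val_le[of _ z] by (intro antisym INF_greatest INF_lower2[of x0]) simp_all
qed

lemma worst_centre: "worst (ub, 0) = objective f0 s r f ub"
proof
  fix x
  obtain \<iota> where "\<iota> \<in> selections" "worst (ub, 0) x = piece \<iota> ub x" using worst_centre_attained by blast
  moreover obtain \<iota>' where "\<iota>' \<in> selections" "objective f0 s r f ub x = piece \<iota>' ub x"
    using objective_attained by blast
  ultimately show "worst (ub, 0) x = objective f0 s r f ub x"
    using piece_le_objective[of \<iota> ub x] worst_centre_upper[of \<iota>' x] by simp
qed

text \<open>Each summand is at most the maximum of its block, so equality of the sums forces
  equality in every block.\<close>

lemma active_selection:
  assumes "\<iota> \<in> selections" "piece \<iota> ub x = objective f0 s r f ub x" "k \<in> {1..s}"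
  shows "\<iota> k \<in> active r f ub k x"
proof -
  have "(\<Sum>k=1..s. f k (\<iota> k) ub x) = (\<Sum>k=1..s. Max ((\<lambda>i. f k i ub x) ` {1..r k}))"
    using assms(2) unfolding piece_def objective_def by simp
  then have "f k (\<iota> k) ub x = Max ((\<lambda>i. f k i ub x) ` {1..r k})"
    by (rule sum_mono_inv) (use assms in \<open>auto dest: selectionsD intro!: Max_ge\<close>)
  then show ?thesis using selectionsD[OF assms(1,3)] unfolding active_def by simp
qed

section \<open>Active gradients and the Lipschitz bound in block form\<close>

lemma active_subset: "active r f ub k x \<subseteq> {1..r k}" "finite (active r f ub k x)"
  unfolding active_def by auto

text \<open>The gradient of \<open>f k i\<close> lies in block \<open>k\<close>, so its inner
  product with \<open>w\<close> sees only that block of \<open>w\<close>.\<close>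

lemma active_gradsE:
  assumes "c \<in> active_grads x"
  obtains \<iota> w where "\<And>k. k \<in> {1..s} \<Longrightarrow> \<iota> k \<in> active r f ub k x" "w \<in> unit_box"
    "c = (\<Sum>k=1..s. (grad1 (f k (\<iota> k)) ub x, inner (grad1 (f k (\<iota> k)) ub x) (blockpart blk k w)))"
proof -
  obtain \<iota> w where \<iota>: "\<iota> \<in> selections" "w \<in> unit_box" "piece \<iota> ub x = objective f0 s r f ub x"
    and c: "c = (piece_grad \<iota> ub x, inner (piece_grad \<iota> ub x) w)"
    using assms unfolding active_grads_def worst_centre by blast
  have "c = (\<Sum>k=1..s. (grad1 (f k (\<iota> k)) ub x, inner (grad1 (f k (\<iota> k)) ub x) (blockpart blk k w)))"
    using \<iota>(1) unfolding c piece_grad_def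
    by (auto simp: prod_eq_iff fst_sum snd_sum inner_sum_left inner_blockpart grad1_block
        dest: selectionsD intro!: sum.cong)
  then show thesis using that \<iota> active_selection by blast
qed

text \<open>The square root is the Euclidean norm of the pair formed by the gradient and its inner
  product with \<open>w\<close>.\<close>

abbreviation block_lip :: "nat \<Rightarrow> nat \<Rightarrow> real^'n \<Rightarrow> real" where
  "block_lip k i x \<equiv> (SUP w\<in>{w \<in> block_space blk k. nrm k w \<le> 1}.
     sqrt ((norm (grad1 (f k i) ub x))\<^sup>2 + (inner (grad1 (f k i) ub x) w)\<^sup>2))"

lemma block_lip_upper:
  assumes "k \<in> {1..s}" "w \<in> block_space blk k" "nrm k w \<le> 1"
  shows "norm (grad1 (f k i) ub x, inner (grad1 (f k i) ub x) w) \<le> block_lip k i x"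
proof -
  have "compact ((\<lambda>w. sqrt ((norm (grad1 (f k i) ub x))\<^sup>2 + (inner (grad1 (f k i) ub x) w)\<^sup>2)) `
      {w \<in> block_space blk k. nrm k w \<le> 1})"
    by (intro compact_continuous_image block_ball_compact continuous_intros assms)
  then show ?thesis
    unfolding norm_Pair real_norm_def power2_abs
    using assms by (intro cSUP_upper bounded_imp_bdd_above compact_imp_bounded) auto
qed

text \<open>The triangle inequality splits the norm over the blocks. Within a block only one active
  index is selected, and its term is at most the sum over all active indices since the terms are
  nonnegative.\<close>

lemma norm_active_grads_le:
  assumes "c \<in> active_grads x"
  shows "norm c \<le> (\<Sum>k=1..s. \<Sum>i\<in>active r f ub k x. block_lip k i x)"
proof -
  obtain \<iota> w where \<iota>: "\<And>k. k \<in> {1..s} \<Longrightarrow> \<iota> k \<in> active r f ub k x" and w: "w \<in> unit_box"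
    and c: "c = (\<Sum>k=1..s. (grad1 (f k (\<iota> k)) ub x, inner (grad1 (f k (\<iota> k)) ub x) (blockpart blk k w)))"
    by (rule active_gradsE[OF assms]) blast
  have "norm (grad1 (f k (\<iota> k)) ub x, inner (grad1 (f k (\<iota> k)) ub x) (blockpart blk k w))
      \<le> (\<Sum>i\<in>active r f ub k x. block_lip k i x)" if k: "k \<in> {1..s}" for k
  proof -
    have pos: "block_lip k i x \<ge> 0" for i
      using block_lip_upper[OF k subspace_0[OF subspace_block_space], of i x] nrm_zero[OF k]
        order_trans[OF norm_ge_zero] by simp
    have "norm (grad1 (f k (\<iota> k)) ub x, inner (grad1 (f k (\<iota> k)) ub x) (blockpart blk k w))
        \<le> block_lip k (\<iota> k) x"
      using w k by (intro block_lip_upper) (auto simp: unit_box_def)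
    also have "\<dots> \<le> (\<Sum>i\<in>active r f ub k x. block_lip k i x)"
      using \<iota>[OF k] active_subset by (intro member_le_sum pos)
    finally show ?thesis .
  qed
  then show ?thesis unfolding c by (intro sum_norm_le)
qed

lemma minimizers_nonempty: "minimizers X (objective f0 s r f ub) \<noteq> {}"
  using worst_attains_inf[of "(ub, 0)"] unfolding worst_centre minimizers_def by blast

lemma lip_mod_minval_le:
  "lip_mod (minval blk s nrm f0 X r f) (ub, 0)
     \<le> (SUP xb\<in>minimizers X (objective f0 s r f ub).
          ereal (\<Sum>k=1..s. \<Sum>i\<in>active r f ub k xb. block_lip k i xb))" (is "_ \<le> ?R")
proof (cases ?R)
  case (real L)
  have "norm c \<le> L" if x: "x \<in> minimizers X (worst (ub, 0))" and c: "c \<in> active_grads x" for x c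
  proof -
    have "ereal (norm c) \<le> ?R"
      using x norm_active_grads_le[OF c] unfolding worst_centre by (intro SUP_upper2[of x]) auto
    then show ?thesis using real by simp
  qed
  then show ?thesis unfolding minval_eq real by (rule lip_mod_val_le)
next
  \<comment> \<open>This case is contradictory because a nominal minimizer exists; an infinite upper
    bound is trivial.\<close>
  case MInf
  obtain x where "x \<in> minimizers X (objective f0 s r f ub)" using minimizers_nonempty by blast
  then have "ereal (\<Sum>k=1..s. \<Sum>i\<in>active r f ub k x. block_lip k i x) \<le> ?R" by (rule SUP_upper)
  then show ?thesis unfolding MInf by simp
qed simp

text \<open>Cauchy-Schwarz bounds the inner product by the norm of the gradient, with equality at
  the normalized gradient. Since \<open>sgn 0 = 0\<close>, this also covers a vanishing
  gradient.\<close>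

lemma block_lip_euclidean:
  assumes "\<forall>w\<in>block_space blk k. nrm k w = norm w" "k \<in> {1..s}" "i \<in> {1..r k}"
  shows "block_lip k i x = sqrt 2 * norm (grad1 (f k i) ub x)"
proof -
  let ?g = "grad1 (f k i) ub x"
  have g: "?g \<in> block_space blk k" using grad1_block assms by blast
  have sgn: "inner ?g (sgn ?g) = norm ?g"
    by (cases "?g = 0") (simp_all add: sgn_div_norm dot_square_norm power2_eq_square)
  have "sgn ?g \<in> {w \<in> block_space blk k. nrm k w \<le> 1}"
    using assms(1) g subspace_scale[OF subspace_block_space g]
    by (cases "?g = 0") (simp_all add: sgn_div_norm)
  moreover have "sqrt ((norm ?g)\<^sup>2 + (inner ?g (sgn ?g))\<^sup>2) = sqrt 2 * norm ?g"
    unfolding sgn by (simp add: real_sqrt_mult flip: mult_2)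
  ultimately have att: "sqrt 2 * norm ?g \<in> (\<lambda>w. sqrt ((norm ?g)\<^sup>2 + (inner ?g w)\<^sup>2)) `
      {w \<in> block_space blk k. nrm k w \<le> 1}" by (metis (no_types, lifting) imageI)
  show ?thesis
  proof (rule cSup_eq_maximum[OF att])
    fix a assume "a \<in> (\<lambda>w. sqrt ((norm ?g)\<^sup>2 + (inner ?g w)\<^sup>2)) ` {w \<in> block_space blk k. nrm k w \<le> 1}"
    then obtain w where w: "norm w \<le> 1" "a = sqrt ((norm ?g)\<^sup>2 + (inner ?g w)\<^sup>2)" using assms(1) by auto
    have "\<bar>inner ?g w\<bar> \<le> norm ?g * norm w" by (rule Cauchy_Schwarz_ineq2)
    also have "\<dots> \<le> norm ?g" using w by (simp add: mult_left_le)
    finally have "(inner ?g w)\<^sup>2 \<le> (norm ?g)\<^sup>2"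
      by (subst abs_le_square_iff[symmetric]) simp
    then have "a \<le> sqrt (2 * (norm ?g)\<^sup>2)" unfolding w by simp
    then show "a \<le> sqrt 2 * norm ?g" by (simp add: real_sqrt_mult)
  qed
qed

lemma lip_bound_euclidean:
  assumes "\<forall>k\<in>{1..s}. \<forall>w\<in>block_space blk k. nrm k w = norm w"
  shows "(SUP xb\<in>minimizers X (objective f0 s r f ub).
            ereal (\<Sum>k=1..s. \<Sum>i\<in>active r f ub k xb. block_lip k i xb))
      = ereal (sqrt 2) * (SUP xb\<in>minimizers X (objective f0 s r f ub).
            ereal (\<Sum>k=1..s. \<Sum>i\<in>active r f ub k xb. norm (grad1 (f k i) ub xb)))"
proof -
  have "(\<Sum>k=1..s. \<Sum>i\<in>active r f ub k x. block_lip k i x) =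
      sqrt 2 * (\<Sum>k=1..s. \<Sum>i\<in>active r f ub k x. norm (grad1 (f k i) ub x))" for x
    unfolding sum_distrib_left using assms active_subset(1)
    by (intro sum.cong refl block_lip_euclidean) blast+
  \<comment> \<open>Pulling \<open>sqrt 2\<close> out of the extended-real supremum relies on
    nonnegative sums and a nonempty set of minimizers.\<close>
  then show ?thesis
    by (subst SUP_ereal_mult_left[symmetric]) (auto intro!: sum_nonneg simp: minimizers_nonempty)
qed

text \<open>Points of the hull that select the same \<open>i\<close> in block \<open>k\<close> share the gradient of \<open>f k i\<close>, so their
  weights add up to \<open>y k i\<close> and their directions average to \<open>w k i\<close>.\<close>

lemma convex_hull_active_grads_multipliers:
  assumes "(g, \<gamma>) \<in> convex hull active_grads x"
  shows "\<exists>w y.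
     (\<forall>k\<in>{1..s}. \<forall>i\<in>active r f ub k x.
         w k i \<in> block_space blk k \<and> nrm k (w k i) \<le> 1 \<and> 0 \<le> y k i) \<and>
     (\<forall>k\<in>{1..s}. (\<Sum>i\<in>active r f ub k x. y k i) = 1) \<and>
     g = (\<Sum>k=1..s. \<Sum>i\<in>active r f ub k x. y k i *\<^sub>R grad1 (f k i) ub x) \<and>
     \<gamma> = (\<Sum>k=1..s. \<Sum>i\<in>active r f ub k x. y k i * inner (grad1 (f k i) ub x) (w k i))"
proof -
  obtain S l where S: "finite S" "S \<subseteq> active_grads x" and l: "\<And>c. c \<in> S \<Longrightarrow> 0 \<le> l c" "sum l S = 1"
    and gl: "(\<Sum>c\<in>S. l c *\<^sub>R c) = (g, \<gamma>)"
  proof -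
    have "\<exists>S l. finite S \<and> S \<subseteq> active_grads x \<and> (\<forall>c\<in>S. 0 \<le> l c) \<and> sum l S = 1 \<and>
        (\<Sum>c\<in>S. l c *\<^sub>R c) = (g, \<gamma>)"
      using assms unfolding convex_hull_explicit by simp
    then show thesis using that by blast
  qed
  let ?G = "\<lambda>k i. grad1 (f k i) ub x"
  define R where "R c \<iota> w \<longleftrightarrow> (\<forall>k\<in>{1..s}. \<iota> k \<in> active r f ub k x) \<and> w \<in> unit_box \<and>
      c = (\<Sum>k=1..s. (?G k (\<iota> k), inner (?G k (\<iota> k)) (blockpart blk k w)))" for c \<iota> w
  have "\<exists>\<iota> w. R c \<iota> w" if "c \<in> S" for c
    unfolding R_def by (rule active_gradsE[OF subsetD[OF S(2) that]]) blast
  then obtain \<iota> \<omega> where R: "\<And>c. c \<in> S \<Longrightarrow> R c (\<iota> c) (\<omega> c)" by metis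
  have \<iota>: "\<iota> c k \<in> active r f ub k x" if "c \<in> S" "k \<in> {1..s}" for c k
    using R that unfolding R_def by blast
  have \<omega>: "\<omega> c \<in> unit_box" if "c \<in> S" for c
    using R that unfolding R_def by blast
  have c: "c = (\<Sum>k=1..s. (?G k (\<iota> c k), inner (?G k (\<iota> c k)) (blockpart blk k (\<omega> c))))" if "c \<in> S" for c
    using R[OF that] unfolding R_def by blast
  define T where "T k i = {c \<in> S. \<iota> c k = i}" for k i
  define y where "y k i = sum l (T k i)" for k i
  \<comment> \<open>If \<open>y k i = 0\<close>, division by zero yields \<open>w k i = 0\<close>,
    which still lies in the unit ball.\<close>
  define w where "w k i = (\<Sum>c\<in>T k i. (l c / y k i) *\<^sub>R blockpart blk k (\<omega> c))" for k i
  have T: "finite (T k i)" "T k i \<subseteq> S" for k i using S by (auto simp: T_def)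
  have y0: "0 \<le> y k i" for k i unfolding y_def using T(2) l(1) by (intro sum_nonneg) blast
  \<comment> \<open>For fixed \<open>k\<close> the sets \<open>T k i\<close> with \<open>i\<close>
    active partition \<open>S\<close>.\<close>
  have group: "(\<Sum>i\<in>active r f ub k x. \<Sum>c\<in>T k i. h c) = sum h S" if "k \<in> {1..s}" for k and h :: "_ \<Rightarrow> 'z::comm_monoid_add"
    unfolding T_def using \<iota> that S active_subset(2) by (intro sum.group) auto
  \<comment> \<open>A vanishing total of nonnegative weights makes each of them vanish, so
    cancelling \<open>y k i\<close> in \<open>yw\<close> below is sound also in that case.\<close>
  have w_zero: "l c = 0" if "y k i = 0" "c \<in> T k i" for k i c
    using that T(1) sum_nonneg_eq_0_iff[of "T k i" l] T(2) l(1) unfolding y_def by blast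
  have w: "w k i \<in> {w \<in> block_space blk k. nrm k w \<le> 1}" if k: "k \<in> {1..s}" for k i
  proof (cases "y k i = 0")
    case True
    then show ?thesis using subspace_0[OF subspace_block_space, of blk k] nrm_zero[OF k] by (simp add: w_def)
  next
    case False
    show ?thesis unfolding w_def
    proof (rule convex_sum[OF T(1)])
      show "convex {w \<in> block_space blk k. nrm k w \<le> 1}"
        using convex_unit_ball_on[OF subspace_block_space] nrm_norm k by blast
      show "(\<Sum>c\<in>T k i. l c / y k i) = 1" using False by (simp add: y_def flip: sum_divide_distrib)
      show "0 \<le> l c / y k i" if "c \<in> T k i" for c using l(1) T(2) that y0 by (intro divide_nonneg_nonneg) blast+
      show "blockpart blk k (\<omega> c) \<in> {w \<in> block_space blk k. nrm k w \<le> 1}" if "c \<in> T k i" for c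
        using \<omega>[OF subsetD[OF T(2) that]] k by (simp add: unit_box_def)
    qed
  qed
  have yw: "y k i * inner (?G k i) (w k i) = (\<Sum>c\<in>T k i. l c * inner (?G k (\<iota> c k)) (blockpart blk k (\<omega> c)))" for k i
    unfolding w_def inner_sum_right sum_distrib_left
    using w_zero[of k i] by (intro sum.cong refl) (auto simp: T_def)
  have yg: "y k i *\<^sub>R ?G k i = (\<Sum>c\<in>T k i. l c *\<^sub>R ?G k (\<iota> c k))" for k i
    unfolding y_def scaleR_sum_left by (intro sum.cong refl) (auto simp: T_def)
  have "(g, \<gamma>) = (\<Sum>c\<in>S. l c *\<^sub>R (\<Sum>k=1..s. (?G k (\<iota> c k), inner (?G k (\<iota> c k)) (blockpart blk k (\<omega> c)))))"
    unfolding gl[symmetric] using c by (intro sum.cong refl) simp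
  also have "\<dots> = (\<Sum>k=1..s. \<Sum>c\<in>S. l c *\<^sub>R (?G k (\<iota> c k), inner (?G k (\<iota> c k)) (blockpart blk k (\<omega> c))))"
    unfolding scaleR_sum_right by (rule sum.swap)
  finally have *: "g = (\<Sum>k=1..s. \<Sum>c\<in>S. l c *\<^sub>R ?G k (\<iota> c k))"
    "\<gamma> = (\<Sum>k=1..s. \<Sum>c\<in>S. l c * inner (?G k (\<iota> c k)) (blockpart blk k (\<omega> c)))"
    by (auto simp: prod_eq_iff fst_sum snd_sum)
  have "g = (\<Sum>k=1..s. \<Sum>i\<in>active r f ub k x. y k i *\<^sub>R ?G k i)"
    "\<gamma> = (\<Sum>k=1..s. \<Sum>i\<in>active r f ub k x. y k i * inner (?G k i) (w k i))"
    unfolding * yg yw by (intro sum.cong refl group[symmetric]; simp)+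
  moreover have "(\<Sum>i\<in>active r f ub k x. y k i) = 1" if "k \<in> {1..s}" for k
    unfolding y_def group[OF that] by (rule l(2))
  ultimately show ?thesis
    using w y0 by (intro exI[of _ w] exI[of _ y] conjI ballI) simp_all
qed

end

theorem theorem1:
  fixes f0 :: "real^'n \<Rightarrow> real"
    and X :: "(real^'n) set"
    and s :: nat
    and r :: "nat \<Rightarrow> nat"
    and f :: "nat \<Rightarrow> nat \<Rightarrow> real^'m \<Rightarrow> real^'n \<Rightarrow> real"
    and blk :: "'m \<Rightarrow> nat"
    and nrm :: "nat \<Rightarrow> real^'m \<Rightarrow> real"
    and ub :: "real^'m"
  assumes f0_lip: "loc_lip (\<lambda>x. ereal (f0 x))"
    and X_compact: "compact X" and X_ne: "X \<noteq> {}"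
    and blk_range: "\<forall>j. blk j \<in> {1..s}"
    and r_pos: "\<forall>k\<in>{1..s}. 1 \<le> r k"
    and f_block: "\<forall>k\<in>{1..s}. \<forall>i\<in>{1..r k}. \<forall>v x. f k i v x = f k i (blockpart blk k v) x"
    and f_C1: "\<forall>k\<in>{1..s}. \<forall>i\<in>{1..r k}. C1_fun (\<lambda>(v, x). f k i v x)"
    and nrm_norm: "\<forall>k\<in>{1..s}. is_norm_on (block_space blk k) (nrm k)"
  shows
    "loc_lip_at (minval blk s nrm f0 X r f) (ub, 0)
     \<and> lip_mod (minval blk s nrm f0 X r f) (ub, 0)
         \<le> (SUP xb\<in>minimizers X (objective f0 s r f ub).
              ereal (\<Sum>k=1..s. \<Sum>i\<in>active r f ub k xb.
                 (SUP w\<in>{w \<in> block_space blk k. nrm k w \<le> 1}.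
                    sqrt ((norm (grad1 (f k i) ub xb))\<^sup>2 + (inner (grad1 (f k i) ub xb) w)\<^sup>2))))
     \<and> ((\<forall>k\<in>{1..s}. \<forall>w\<in>block_space blk k. nrm k w = norm w) \<longrightarrow>
          (SUP xb\<in>minimizers X (objective f0 s r f ub).
              ereal (\<Sum>k=1..s. \<Sum>i\<in>active r f ub k xb.
                 (SUP w\<in>{w \<in> block_space blk k. nrm k w \<le> 1}.
                    sqrt ((norm (grad1 (f k i) ub xb))\<^sup>2 + (inner (grad1 (f k i) ub xb) w)\<^sup>2))))
          = ereal (sqrt 2) * (SUP xb\<in>minimizers X (objective f0 s r f ub).
              ereal (\<Sum>k=1..s. \<Sum>i\<in>active r f ub k xb. norm (grad1 (f k i) ub xb))))
     \<and> (\<forall>g \<gamma>. (g, \<gamma>) \<in> limiting_subdiff (minval blk s nrm f0 X r f) (ub, 0) \<longrightarrow>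
          (\<exists>xb\<in>minimizers X (objective f0 s r f ub). \<exists>w y.
             (\<forall>k\<in>{1..s}. \<forall>i\<in>active r f ub k xb.
                 w k i \<in> block_space blk k \<and> nrm k (w k i) \<le> 1 \<and> 0 \<le> y k i) \<and>
             (\<forall>k\<in>{1..s}. (\<Sum>i\<in>active r f ub k xb. y k i) = 1) \<and>
             g = (\<Sum>k=1..s. \<Sum>i\<in>active r f ub k xb. y k i *\<^sub>R grad1 (f k i) ub xb) \<and>
             \<gamma> = (\<Sum>k=1..s. \<Sum>i\<in>active r f ub k xb. y k i * inner (grad1 (f k i) ub xb) (w k i))))"
proof -
  interpret robust_problem f0 X s r f blk nrm ub
    by unfold_locales (fact assms)+
  show ?thesis
  proof (intro conjI impI allI)
    show "loc_lip_at (minval blk s nrm f0 X r f) (ub, 0)"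
      unfolding minval_eq by (rule loc_lip_at_val)
  next
    fix g \<gamma> assume "(g, \<gamma>) \<in> limiting_subdiff (minval blk s nrm f0 X r f) (ub, 0)"
    then obtain xb where "xb \<in> minimizers X (objective f0 s r f ub)" "(g, \<gamma>) \<in> convex hull active_grads xb"
      using limiting_subdiff_val unfolding minval_eq worst_centre by blast
    then show "\<exists>xb\<in>minimizers X (objective f0 s r f ub). \<exists>w y.
             (\<forall>k\<in>{1..s}. \<forall>i\<in>active r f ub k xb.
                 w k i \<in> block_space blk k \<and> nrm k (w k i) \<le> 1 \<and> 0 \<le> y k i) \<and>
             (\<forall>k\<in>{1..s}. (\<Sum>i\<in>active r f ub k xb. y k i) = 1) \<and>
             g = (\<Sum>k=1..s. \<Sum>i\<in>active r f ub k xb. y k i *\<^sub>R grad1 (f k i) ub xb) \<and>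
             \<gamma> = (\<Sum>k=1..s. \<Sum>i\<in>active r f ub k xb. y k i * inner (grad1 (f k i) ub xb) (w k i))"
      using convex_hull_active_grads_multipliers by (intro bexI[of _ xb])
  qed (fact lip_mod_minval_le, fact lip_bound_euclidean)
qed

end
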